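(* Let $\mathcal{L}$ be any fixed linear equation in two variables. Then $\mathcal{L}$-\textsc{Free Subset} is in $\mathsf{P}$.
   Context: A linear equation $\mathcal{L}$ in variables $x_1,\dots,x_m$ has the form $c_1x_1+\dots+c_mx_m=d$ with fixed integers $c_i,d$. A solution $(x_1,\dots,x_m)$ is trivial if there is a partition $P_1,\dots,P_r$ of $\{1,\dots,m\}$ such that $x_i=x_j$ whenever $i,j$ lie in the same class, and $\sum_{i\in P_s}c_i=0$ for each class. A set $A$ of integers is $\mathcal{L}$-free if there is no non-trivial solution of $\mathcal{L}$ all of whose entries lie in $A$. The problem $\mathcal{L}$-\textsc{Free Subset}: given a finite set $A\subseteq\mathbb{Z}$ (integers encoded in binary) and $k\in\mathbb{N}$, decide whether there is an $\mathcal{L}$-free subset $A'\subseteq A$ with $|A'|=k$. Polynomial time means polynomial in the number of bits of the input. *)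

theory Defs
  imports Main "HOL-Library.Disjoint_Sets" "HOL-Computational_Algebra.Polynomial"
begin

section \<open>Linear equations and free sets\<close>

text \<open>
  The equation \<open>c\<^sub>1 x\<^sub>1 + \<dots> + c\<^sub>m x\<^sub>m = d\<close> is given by the list of its coefficients, so
  \<open>m\<close> is the length of \<open>coeffs\<close>. Coefficients may be zero. An assignment of the variables is a
  list of length \<open>m\<close>; variables are numbered from \<open>0\<close>.
\<close>

record lin_eq =
  coeffs :: "int list"
  rhs :: int

definition num_vars :: "lin_eq \<Rightarrow> nat" where
  "num_vars \<L> = length (coeffs \<L>)"

definition is_solution :: "lin_eq \<Rightarrow> int list \<Rightarrow> bool" where
  "is_solution \<L> x \<longleftrightarrow>
     length x = num_vars \<L> \<and> (\<Sum>i<num_vars \<L>. coeffs \<L> ! i * x ! i) = rhs \<L>"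

definition trivial_solution :: "lin_eq \<Rightarrow> int list \<Rightarrow> bool" where
  "trivial_solution \<L> x \<longleftrightarrow> is_solution \<L> x \<and>
     (\<exists>P. partition_on {..<num_vars \<L>} P \<and>
          (\<forall>C\<in>P. (\<forall>i\<in>C. \<forall>j\<in>C. x ! i = x ! j) \<and> (\<Sum>i\<in>C. coeffs \<L> ! i) = 0))"

definition eq_free :: "lin_eq \<Rightarrow> int set \<Rightarrow> bool" where
  "eq_free \<L> A \<longleftrightarrow>
     \<not> (\<exists>x. set x \<subseteq> A \<and> is_solution \<L> x \<and> \<not> trivial_solution \<L> x)"

definition has_free_subset :: "lin_eq \<Rightarrow> int set \<Rightarrow> nat \<Rightarrow> bool" where
  "has_free_subset \<L> A k \<longleftrightarrow> (\<exists>A'\<subseteq>A. eq_free \<L> A' \<and> card A' = k)"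


section \<open>Deterministic multi-tape Turing machines and the class P\<close>

text \<open>
  States and tape symbols are natural numbers below \<open>num_states\<close> and \<open>num_symbols\<close>. Symbol \<open>0\<close>
  is the blank; symbols \<open>1\<close> and \<open>2\<close> stand for the input bits \<open>False\<close> and \<open>True\<close>. From the
  current state and the list of symbols under the heads, \<open>trans\<close> yields the next state and, for
  each tape, the symbol to write and the head movement.
\<close>

datatype direction = Move_Left | Stay | Move_Right

record turing_machine =
  num_tapes :: nat
  num_states :: nat
  num_symbols :: nat
  start_state :: nat
  accept_state :: nat
  reject_state :: nat
  trans :: "nat \<Rightarrow> nat list \<Rightarrow> nat \<times> (nat \<times> direction) list"

definition wf_tm :: "turing_machine \<Rightarrow> bool" where
  "wf_tm M \<longleftrightarrow>
     num_tapes M \<ge> 1 \<and> num_symbols M \<ge> 3 \<and>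
     start_state M < num_states M \<and> accept_state M < num_states M \<and>
     reject_state M < num_states M \<and> accept_state M \<noteq> reject_state M \<and>
     (\<forall>q ss. q < num_states M \<longrightarrow> length ss = num_tapes M \<longrightarrow> set ss \<subseteq> {..<num_symbols M} \<longrightarrow>
        (case trans M q ss of (q', acts) \<Rightarrow>
           q' < num_states M \<and> length acts = num_tapes M \<and>
           fst ` set acts \<subseteq> {..<num_symbols M}))"

text \<open>
  A tape is two-way infinite and comes with the position of its head; a configuration consists
  of the current state and the tapes.
\<close>

type_synonym tape = "(int \<Rightarrow> nat) \<times> int"
type_synonym config = "nat \<times> tape list"

definition read_tape :: "tape \<Rightarrow> nat" where
  "read_tape t = (case t of (f, p) \<Rightarrow> f p)"

definition act_tape :: "nat \<times> direction \<Rightarrow> tape \<Rightarrow> tape" where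
  "act_tape a t = (case (a, t) of ((s, m), (f, p)) \<Rightarrow>
     (f(p := s), (case m of Move_Left \<Rightarrow> p - 1 | Stay \<Rightarrow> p | Move_Right \<Rightarrow> p + 1)))"

definition step :: "turing_machine \<Rightarrow> config \<Rightarrow> config" where
  "step M c = (case c of (q, ts) \<Rightarrow>
     if q = accept_state M \<or> q = reject_state M then c
     else (case trans M q (map read_tape ts) of (q', acts) \<Rightarrow> (q', map2 act_tape acts ts)))"

definition input_tape :: "bool list \<Rightarrow> tape" where
  "input_tape w =
     (\<lambda>i. if 0 \<le> i \<and> i < int (length w) then (if w ! nat i then 2 else 1) else 0, 0)"

definition init_config :: "turing_machine \<Rightarrow> bool list \<Rightarrow> config" where
  "init_config M w =
     (start_state M, input_tape w # replicate (num_tapes M - 1) (\<lambda>_. 0, 0))"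

definition decides_in_time ::
    "turing_machine \<Rightarrow> bool list set \<Rightarrow> (nat \<Rightarrow> nat) \<Rightarrow> bool" where
  "decides_in_time M X T \<longleftrightarrow>
     (\<forall>w. \<exists>t \<le> T (length w).
        fst ((step M ^^ t) (init_config M w)) =
          (if w \<in> X then accept_state M else reject_state M))"

definition class_P :: "bool list set set" where
  "class_P = {X. \<exists>M (p :: nat poly). wf_tm M \<and> decides_in_time M X (poly p)}"


section \<open>The decision problem as a language\<close>

text \<open>
  Numbers are written in binary, least significant bit first and without superfluous zeros (so
  \<open>0\<close> is the empty word). An instance is first written over a four-letter alphabet, with every
  number terminated by a separator, and each letter is then encoded by two bits.
\<close>

datatype letter = Digit bool | Minus | Sep

fun letter_bits :: "letter \<Rightarrow> bool list" where
  "letter_bits (Digit b) = [False, b]"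
| "letter_bits Minus = [True, False]"
| "letter_bits Sep = [True, True]"

fun binary :: "nat \<Rightarrow> bool list" where
  "binary n = (if n = 0 then [] else odd n # binary (n div 2))"

declare binary.simps [simp del]

definition nat_letters :: "nat \<Rightarrow> letter list" where
  "nat_letters n = map Digit (binary n) @ [Sep]"

definition int_letters :: "int \<Rightarrow> letter list" where
  "int_letters x = (if x < 0 then [Minus] else []) @ nat_letters (nat \<bar>x\<bar>)"

definition encode_instance :: "int list \<Rightarrow> nat \<Rightarrow> bool list" where
  "encode_instance xs k =
     concat (map letter_bits (nat_letters k @ concat (map int_letters xs)))"

text \<open>
  The finite set \<open>A\<close> is presented as a list of its elements in arbitrary order and without
  repetitions. Words that do not encode an instance do not belong to the language.
\<close>

definition Free_Subset :: "lin_eq \<Rightarrow> bool list set" where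
  "Free_Subset \<L> =
     {encode_instance xs k | xs k. distinct xs \<and> has_free_subset \<L> (set xs) k}"

end

theory Submission
  imports Defs
begin

text \<open>
  For two variables, the non-trivial solutions of the equation are the edges of a digraph on \<open>A\<close>,
  and free sets are its independent sets. A vertex without a loop has at most one successor, so
  every kernel, i.e. every fixed point of the rule that \<open>x\<close> is marked iff it has no loop and no
  marked predecessor, is an independent set of maximum size. Re-evaluating the marks of all vertices in
  turn, \<open>\<bar>A\<bar>\<close> times, reaches a fixed point: except when \<open>c1 = c2 \<noteq> 0\<close>, edges are strictly monotone in a
  suitable integer key, so that the marks settle in the order of the keys; in that case the graph
  is a matching, for which a single round is enough.

  Whether \<open>c1 y + c2 x = d\<close> holds is decided digit by digit by a finite automaton, whose state is
  the carry. The Turing machine therefore only has to scan and rotate the list of numbers. It is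
  obtained from a program for a machine with several stacks and a finite memory, each stack
  being a tape and the continuations of the program being the states.
\<close>

section \<open>Programs for stack machines\<close>

text \<open>Membership in \<open>class_P\<close> calls for a concrete machine, so the algorithm is
  chosen for the simplicity of its control. Selecting vertices greedily in the order of the keys
  would require sorting by the keys, or dividing to compute neighbours. Here the key occurs only in
  the convergence argument, and the program has the same shape for all coefficients, degenerate ones
  included. It never has to recognize that it is done: once all marks are settled, further updates
  change nothing, so any sufficiently large number of rounds gives the same marks. Hence it performs
  \<open>N * N\<close> single updates, where \<open>N\<close> is the number of input bits, a number
  that parsing can supply in unary. Each update compares one number with all the others anyway, and
  this comparison also reveals repeated elements, which an instance must not contain. Finally,
  subsets of free sets are free, so the answer depends only on whether \<open>k\<close> is at most
  the number of marks.\<close>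

datatype act = Keep | Pop | Push nat

datatype 'm prog =
    Do "'m \<Rightarrow> (nat \<Rightarrow> nat) \<Rightarrow> 'm" "'m \<Rightarrow> (nat \<Rightarrow> nat) \<Rightarrow> nat \<Rightarrow> act"
  | Seq "'m prog" "'m prog"
  | Cond "'m \<Rightarrow> (nat \<Rightarrow> nat) \<Rightarrow> bool" "'m prog" "'m prog"
  | While "'m \<Rightarrow> (nat \<Rightarrow> nat) \<Rightarrow> bool" "'m prog"

fun perform :: "act \<Rightarrow> nat list \<Rightarrow> nat list" where
  "perform Keep xs = xs"
| "perform Pop xs = tl xs"
| "perform (Push a) xs = a # xs"

fun pushed :: "act \<Rightarrow> nat" where
  "pushed (Push a) = a"
| "pushed _ = 0"

fun head_move :: "act \<Rightarrow> direction" where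
  "head_move Keep = Stay"
| "head_move Pop = Move_Right"
| "head_move (Push a) = Move_Left"

fun succs :: "'m prog list \<Rightarrow> 'm prog list set" where
  "succs [] = {}"
| "succs (Do g h # ks) = {ks}"
| "succs (Seq p q # ks) = {p # q # ks}"
| "succs (Cond b p q # ks) = {p # ks, q # ks}"
| "succs (While b p # ks) = {p # While b p # ks, ks}"

text \<open>The program stacks that can occur while \<open>p\<close> runs in front of
  \<open>ks\<close>, with \<open>ks\<close> itself left out. A loop body returns to the loop it came
  from, so recursion on the program already yields a closed set. Its finiteness bounds the number of
  machine states.\<close>

fun conts :: "'m prog \<Rightarrow> 'm prog list \<Rightarrow> 'm prog list set" where
  "conts (Do g h) ks = {Do g h # ks}"
| "conts (Seq p q) ks = insert (Seq p q # ks) (conts p (q # ks) \<union> conts q ks)"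
| "conts (Cond b p q) ks = insert (Cond b p q # ks) (conts p ks \<union> conts q ks)"
| "conts (While b p) ks = insert (While b p # ks) (conts p (While b p # ks))"

lemma finite_conts: "finite (conts p ks)"
  by (induction p ks rule: conts.induct) auto

lemma conts_self: "p # ks \<in> conts p ks"
  by (cases p) auto

lemma conts_closed: "l \<in> conts p ks \<Longrightarrow> succs l \<subseteq> insert ks (conts p ks)"
proof (induction p ks arbitrary: l rule: conts.induct)
  case (2 p q ks)
  have "q # ks \<in> conts q ks" "p # q # ks \<in> conts p (q # ks)" by (rule conts_self)+
  with 2 show ?case by fastforce
next
  case (3 b p q ks)
  have "q # ks \<in> conts q ks" "p # ks \<in> conts p ks" by (rule conts_self)+
  with 3 show ?case by fastforce
next
  case (4 b p ks)
  have "p # While b p # ks \<in> conts p (While b p # ks)" by (rule conts_self)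
  with 4 show ?case by fastforce
qed auto

text \<open>
  A tape carries a stack whose top lies under the head and which grows to the left. The cells to
  the left of the head are arbitrary, so popping need not erase anything, and the input tape
  is such a stack from the start.
\<close>

definition tape_rep :: "nat list \<Rightarrow> tape \<Rightarrow> bool" where
  "tape_rep xs t \<longleftrightarrow> (\<forall>j::nat. fst t (snd t + int j) = (if j < length xs then xs ! j else 0))"

definition peek :: "nat list \<Rightarrow> nat" where
  "peek xs = (case xs of [] \<Rightarrow> 0 | a # _ \<Rightarrow> a)"

lemma peek_simps [simp]: "peek [] = 0" "peek (a # xs) = a"
  by (simp_all add: peek_def)

lemma read_tape_peek:
  assumes "tape_rep xs t"
  shows "read_tape t = peek xs"
proof -
  have "fst t (snd t + int 0) = (if 0 < length xs then xs ! 0 else 0)"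
    using assms unfolding tape_rep_def by blast
  then show ?thesis
    by (cases xs) (auto simp: read_tape_def split: prod.splits)
qed

lemma tape_rep_stay:
  assumes "tape_rep xs t"
  shows "tape_rep xs (act_tape (read_tape t, Stay) t)"
  using assms by (auto simp: tape_rep_def act_tape_def read_tape_def split: prod.splits)

text \<open>These are the two machine steps of a \<open>Do\<close> on one tape: a movement that
  leaves the contents alone, then a writing step in place. As the blank is never pushed,
  \<open>pushed a = 0\<close> can mean that the symbol just read is written back. Popping the empty
  stack moves over blanks, in agreement with \<open>tl [] = []\<close>.\<close>

lemma tape_rep_perform:
  assumes "tape_rep xs t"
    and "t' = act_tape (read_tape t, head_move a) t"
    and "\<And>s. a = Push s \<Longrightarrow> s \<noteq> 0"
  shows "tape_rep (perform a xs)
     (act_tape (if pushed a = 0 then read_tape t' else pushed a, Stay) t')"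
proof (cases a)
  case Keep
  with assms(1,2) show ?thesis
    by (auto simp: tape_rep_def act_tape_def read_tape_def split: prod.splits)
next
  case Pop
  have "fst t (snd t + 1 + int j) = (if j < length (tl xs) then tl xs ! j else 0)" for j
  proof -
    have "fst t (snd t + int (Suc j)) = (if Suc j < length xs then xs ! Suc j else 0)"
      using assms(1) unfolding tape_rep_def by blast
    then show ?thesis by (cases xs) (auto simp: algebra_simps)
  qed
  with Pop assms(2) show ?thesis
    by (auto simp: tape_rep_def act_tape_def read_tape_def split: prod.splits)
next
  case (Push s)
  with assms(3) have "s \<noteq> 0" by blast
  obtain f k where t: "t = (f, k)" by (cases t)
  have "(f(k - 1 := s)) (k - 1 + int j) = (if j < length (s # xs) then (s # xs) ! j else 0)" for j
  proof (cases j)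
    case (Suc i)
    have "f (k + int i) = (if i < length xs then xs ! i else 0)"
      using assms(1) t unfolding tape_rep_def by (metis fst_conv snd_conv)
    with Suc show ?thesis by auto
  qed auto
  moreover have "act_tape (if pushed a = 0 then read_tape t' else pushed a, Stay) t'
      = (f(k - 1 := s), k - 1)"
    using Push \<open>s \<noteq> 0\<close> assms(2) t by (simp add: act_tape_def read_tape_def)
  ultimately show ?thesis using Push by (simp only: tape_rep_def fst_conv snd_conv perform.simps simp_thms)
qed

section \<open>Timed big-step semantics and its simulation by a Turing machine\<close>

locale stack_machine =
  fixes tapes symbols :: nat and mems :: "'m set"
  assumes tapes_pos: "tapes \<ge> 1" and symbols_ge: "symbols \<ge> 3" and finite_mems: "finite mems"
begin

definition tops :: "(nat \<Rightarrow> nat list) \<Rightarrow> nat \<Rightarrow> nat" where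
  "tops \<sigma> i = (if i < tapes then peek (\<sigma> i) else 0)"

text \<open>The number is an upper bound on machine steps: two for a \<open>Do\<close>, because a
  machine step writes before it moves whereas a push must move first, and one for each unfolding of
  a \<open>Seq\<close> or evaluation of a guard. Symbol \<open>0\<close> may not be pushed since as
  a top it means the empty stack.\<close>

inductive run :: "'m prog \<Rightarrow> 'm \<Rightarrow> (nat \<Rightarrow> nat list) \<Rightarrow> nat \<Rightarrow> 'm \<Rightarrow> (nat \<Rightarrow> nat list) \<Rightarrow> bool" where
  run_Do:
  "\<lbrakk>g m (tops \<sigma>) \<in> mems;
    \<And>i a. i < tapes \<Longrightarrow> h m (tops \<sigma>) i = Push a \<Longrightarrow> 0 < a \<and> a < symbols; 2 \<le> n\<rbrakk>
   \<Longrightarrow> run (Do g h) m \<sigma> n (g m (tops \<sigma>)) (\<lambda>i. perform (h m (tops \<sigma>) i) (\<sigma> i))"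
| run_Seq:
  "\<lbrakk>run p m \<sigma> na ma \<rho>; run q ma \<rho> nb mb \<tau>; na + nb + 1 \<le> n\<rbrakk>
   \<Longrightarrow> run (Seq p q) m \<sigma> n mb \<tau>"
| run_Cond:
  "\<lbrakk>run (if b m (tops \<sigma>) then p else q) m \<sigma> na ma \<rho>; na + 1 \<le> n\<rbrakk>
   \<Longrightarrow> run (Cond b p q) m \<sigma> n ma \<rho>"
| run_While_False:
  "\<lbrakk>\<not> b m (tops \<sigma>); 1 \<le> n\<rbrakk> \<Longrightarrow> run (While b p) m \<sigma> n m \<sigma>"
| run_While_True:
  "\<lbrakk>b m (tops \<sigma>); run p m \<sigma> na ma \<rho>; run (While b p) ma \<rho> nb mb \<tau>; na + nb + 1 \<le> n\<rbrakk>
   \<Longrightarrow> run (While b p) m \<sigma> n mb \<tau>"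

definition tapes_rep :: "(nat \<Rightarrow> nat list) \<Rightarrow> tape list \<Rightarrow> bool" where
  "tapes_rep \<sigma> ts \<longleftrightarrow> length ts = tapes \<and> (\<forall>i<tapes. tape_rep (\<sigma> i) (ts ! i))"

text \<open>
  A control state of the machine consists of the symbols still to be written by a push, whose
  head movement comes first, of the programs still to be run, and of the memory.
\<close>

definition control :: "'m prog \<Rightarrow> (nat list option \<times> 'm prog list \<times> 'm) set" where
  "control p = insert None (Some ` {l. set l \<subseteq> {..<symbols} \<and> length l = tapes})
     \<times> insert [] (conts p []) \<times> mems"

lemma finite_control: "finite (control p)"
  unfolding control_def by (simp add: finite_mems finite_conts finite_lists_length_eq)

definition index :: "'m prog \<Rightarrow> nat list option \<times> 'm prog list \<times> 'm \<Rightarrow> nat" where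
  "index p = (SOME h. bij_betw h (control p) {0..<card (control p)})"

lemma bij_index: "bij_betw (index p) (control p) {0..<card (control p)}"
  unfolding index_def by (rule someI_ex[OF ex_bij_betw_finite_nat[OF finite_control]])

text \<open>\<open>wf_tm\<close> quantifies over all states and readings, also over those for which
  \<open>g\<close> leaves \<open>mems\<close> or \<open>h\<close> pushes an illegal symbol. Such
  successors are sent to the rejecting state.\<close>

definition number :: "'m prog \<Rightarrow> nat list option \<times> 'm prog list \<times> 'm \<Rightarrow> nat" where
  "number p c = (if c \<in> control p then index p c else card (control p) + 1)"

definition tm_trans :: "'m prog \<Rightarrow> ('m \<Rightarrow> bool) \<Rightarrow> nat \<Rightarrow> nat list \<Rightarrow> nat \<times> (nat \<times> direction) list" where
  "tm_trans p acc q ss =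
    (let idle = map (\<lambda>s. (s, Stay)) ss; t = (\<lambda>i. if i < tapes then ss ! i else 0) in
     if q \<ge> card (control p) then (q, idle)
     else (case inv_into (control p) (index p) q of
       (Some l, ks, m) \<Rightarrow> (number p (None, ks, m), map2 (\<lambda>a s. (if a = 0 then s else a, Stay)) l ss)
     | (None, [], m) \<Rightarrow> (if acc m then card (control p) else card (control p) + 1, idle)
     | (None, Do g h # ks, m) \<Rightarrow>
         (number p (Some (map (\<lambda>i. pushed (h m t i)) [0..<tapes]), ks, g m t),
          map (\<lambda>i. (ss ! i, head_move (h m t i))) [0..<tapes])
     | (None, Seq c1 c2 # ks, m) \<Rightarrow> (number p (None, c1 # c2 # ks, m), idle)
     | (None, Cond b c1 c2 # ks, m) \<Rightarrow>
         (number p (None, (if b m t then c1 else c2) # ks, m), idle)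
     | (None, While b c # ks, m) \<Rightarrow>
         (number p (None, if b m t then c # While b c # ks else ks, m), idle)))"

definition tm :: "'m prog \<Rightarrow> ('m \<Rightarrow> bool) \<Rightarrow> 'm \<Rightarrow> turing_machine" where
  "tm p acc m0 = \<lparr>num_tapes = tapes, num_states = card (control p) + 2, num_symbols = symbols,
     start_state = number p (None, [p], m0), accept_state = card (control p),
     reject_state = card (control p) + 1, trans = tm_trans p acc\<rparr>"

lemma index_less: "c \<in> control p \<Longrightarrow> index p c < card (control p)"
  using bij_betw_apply[OF bij_index] by fastforce

lemma number_less: "number p c < card (control p) + 2"
  using index_less by (auto simp: number_def less_Suc_eq)

lemma inv_index: "c \<in> control p \<Longrightarrow> inv_into (control p) (index p) (index p c) = c"
  using bij_index[of p] by (simp add: bij_betw_def)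

lemma inv_index_mem: "q < card (control p) \<Longrightarrow> inv_into (control p) (index p) q \<in> control p"
  using bij_index[of p] by (metis atLeastLessThan_iff bij_betw_def inv_into_into zero_le)

lemma wf_tm: "wf_tm (tm p acc m0)"
proof -
  have "case tm_trans p acc q ss of (q', acts) \<Rightarrow>
           q' < card (control p) + 2 \<and> length acts = tapes \<and> fst ` set acts \<subseteq> {..<symbols}"
    if q: "q < card (control p) + 2" and len: "length ss = tapes" and ss: "set ss \<subseteq> {..<symbols}"
    for q ss
  proof (cases "q < card (control p)")
    case False
    with that show ?thesis by (auto simp: tm_trans_def Let_def)
  next
    case True
    obtain l ks m where c: "inv_into (control p) (index p) q = (l, ks, m)"
      by (cases "inv_into (control p) (index p) q")
    with inv_index_mem[OF True] have "(l, ks, m) \<in> control p" by simp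
    then have l: "l' \<in> {l. set l \<subseteq> {..<symbols} \<and> length l = tapes}" if "l = Some l'" for l'
      using that unfolding control_def by blast
    have nth: "ss ! i < symbols" if "i < tapes" for i
      using that len ss by (metis lessThan_iff nth_mem subsetD)
    show ?thesis
    proof (cases l)
      case (Some l')
      have "(if fst as = 0 then snd as else fst as) < symbols" if "as \<in> set (zip l' ss)" for as
      proof -
        obtain a s where as: "as = (a, s)" by (cases as)
        then have "a \<in> set l'" "s \<in> set ss"
          using that set_zip_leftD set_zip_rightD by fast+
        with l[OF Some] ss as show ?thesis by auto
      qed
      with Some c True len l[OF Some] number_less[of p "(None, ks, m)"] show ?thesis
        by (auto simp: tm_trans_def Let_def split_beta)
    next
      case None
      with c True len ss nth number_less show ?thesis
        by (cases ks rule: succs.cases) (auto simp: tm_trans_def Let_def)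
    qed
  qed
  then show ?thesis
    using tapes_pos symbols_ge number_less unfolding wf_tm_def tm_def by simp
qed

lemma map_read_tape: "tapes_rep \<sigma> ts \<Longrightarrow> i < tapes \<Longrightarrow> map read_tape ts ! i = peek (\<sigma> i)"
  by (simp add: tapes_rep_def read_tape_peek)

lemma tapes_rep_idle:
  assumes "tapes_rep \<sigma> ts"
  shows "tapes_rep \<sigma> (map2 act_tape (map (\<lambda>s. (s, Stay)) (map read_tape ts)) ts)"
  using assms by (auto simp: tapes_rep_def intro: tape_rep_stay)

lemma tm_trans_index:
  assumes "c \<in> control p"
  shows "index p c < card (control p)" "inv_into (control p) (index p) (index p c) = c"
  using assms index_less inv_index by auto

lemma step_idle:
  assumes "tapes_rep \<sigma> ts" and "c \<in> control p"
    and "tm_trans p acc (index p c) (map read_tape ts) = (q, map (\<lambda>s. (s, Stay)) (map read_tape ts))"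
  shows "\<exists>ts'. tapes_rep \<sigma> ts' \<and> step (tm p acc m0) (index p c, ts) = (q, ts')"
  using tapes_rep_idle[OF assms(1)] index_less[OF assms(2)] assms(3)
  by (auto simp: step_def tm_def)

lemma tops_eq:
  assumes "tapes_rep \<sigma> ts"
  shows "(\<lambda>i. if i < tapes then map read_tape ts ! i else 0) = tops \<sigma>"
  using map_read_tape[OF assms] by (auto simp: tops_def)

lemma step_Do:
  assumes rep: "tapes_rep \<sigma> ts" and c: "(None, Do g h # ks, m) \<in> control p"
    and ks: "ks \<in> insert [] (conts p [])" and mem: "g m (tops \<sigma>) \<in> mems"
    and push: "\<And>i a. i < tapes \<Longrightarrow> h m (tops \<sigma>) i = Push a \<Longrightarrow> 0 < a \<and> a < symbols"
  shows "\<exists>ts'. tapes_rep (\<lambda>i. perform (h m (tops \<sigma>) i) (\<sigma> i)) ts' \<and>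
     (step (tm p acc m0) ^^ 2) (index p (None, Do g h # ks, m), ts)
       = (index p (None, ks, g m (tops \<sigma>)), ts')"
proof -
  let ?a = "h m (tops \<sigma>)"
  define l where "l = map (\<lambda>i. pushed (?a i)) [0..<tapes]"
  define ts1 where "ts1 = map2 act_tape (map (\<lambda>i. (map read_tape ts ! i, head_move (?a i))) [0..<tapes]) ts"
  define ts2 where "ts2 = map2 act_tape (map2 (\<lambda>a s. (if a = 0 then s else a, Stay)) l (map read_tape ts1)) ts1"
  have len: "length ts = tapes" using rep by (simp add: tapes_rep_def)
  have lens: "length ts1 = tapes" "length ts2 = tapes" "length l = tapes"
    by (simp_all add: ts1_def ts2_def l_def len)
  have "pushed (?a i) < symbols" if "i < tapes" for i
    using push[OF that] symbols_ge by (cases "?a i") auto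
  then have c1: "(Some l, ks, g m (tops \<sigma>)) \<in> control p"
    using ks mem by (auto simp: control_def l_def intro!: imageI)
  have c2: "(None, ks, g m (tops \<sigma>)) \<in> control p"
    using ks mem by (auto simp: control_def)
  have "step (tm p acc m0) (index p (None, Do g h # ks, m), ts)
      = (index p (Some l, ks, g m (tops \<sigma>)), ts1)"
    using tm_trans_index[OF c] c1 tops_eq[OF rep]
    by (simp add: step_def tm_def tm_trans_def Let_def number_def l_def ts1_def)
  moreover have "step (tm p acc m0) (index p (Some l, ks, g m (tops \<sigma>)), ts1)
      = (index p (None, ks, g m (tops \<sigma>)), ts2)"
    using tm_trans_index[OF c1] c2 by (simp add: step_def tm_def tm_trans_def Let_def number_def ts2_def)
  moreover have "tapes_rep (\<lambda>i. perform (?a i) (\<sigma> i)) ts2"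
    unfolding tapes_rep_def
  proof (intro conjI allI impI)
    fix i assume i: "i < tapes"
    have 1: "ts1 ! i = act_tape (read_tape (ts ! i), head_move (?a i)) (ts ! i)"
      using i len by (simp add: ts1_def)
    have "ts2 ! i = act_tape (if pushed (?a i) = 0 then read_tape (ts1 ! i) else pushed (?a i), Stay) (ts1 ! i)"
      using i lens by (simp add: ts2_def l_def)
    with tape_rep_perform[OF _ 1] show "tape_rep (perform (?a i) (\<sigma> i)) (ts2 ! i)"
      using rep i push unfolding tapes_rep_def by fastforce
  qed (simp add: lens)
  ultimately show ?thesis by (auto simp: numeral_2_eq_2)
qed

definition reach :: "'m prog \<Rightarrow> 'm prog list set" where
  "reach p = insert [] (conts p [])"

lemma reach_succs: "l \<in> reach p \<Longrightarrow> l' \<in> succs l \<Longrightarrow> l' \<in> reach p"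
  using conts_closed[of l p "[]"] by (auto simp: reach_def)

text \<open>Control can pass beyond every command: directly for \<open>Do\<close> and
  \<open>While\<close>, and through the components for \<open>Seq\<close> and \<open>Cond\<close>.
  Reachability is meant in the graph of \<open>succs\<close>, so termination is not an
  issue.\<close>

lemma reach_tail: "c # ks \<in> reach p \<Longrightarrow> ks \<in> reach p"
proof (induction c arbitrary: ks)
  case (Seq c d)
  have "c # d # ks \<in> reach p" using reach_succs[OF Seq.prems] by simp
  with Seq.IH show ?case by blast
next
  case (Cond b c d)
  have "c # ks \<in> reach p" using reach_succs[OF Cond.prems] by simp
  with Cond.IH show ?case by blast
qed (auto dest: reach_succs)

lemma control_reach: "(None, ks, m) \<in> control p \<longleftrightarrow> ks \<in> reach p \<and> m \<in> mems"
  by (auto simp: control_def reach_def)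

text \<open>The continuation \<open>ks\<close> is kept general for the induction: the first part of
  a \<open>Seq\<close> runs in front of the second one, and a loop body in front of its own
  loop.\<close>

lemma run_tm:
  assumes "run c m \<sigma> n m' \<sigma>'" and "m \<in> mems" and "c # ks \<in> reach p"
    and "tapes_rep \<sigma> ts"
  shows "m' \<in> mems \<and> (\<exists>n' ts'. n' \<le> n \<and> tapes_rep \<sigma>' ts' \<and>
     (step (tm p acc mi) ^^ n') (index p (None, c # ks, m), ts) = (index p (None, ks, m'), ts'))"
  using assms
proof (induction arbitrary: ks ts rule: run.induct)
  case (run_Do g m \<sigma> h n)
  have "(None, Do g h # ks, m) \<in> control p" using run_Do by (simp add: control_reach)
  moreover have "ks \<in> insert [] (conts p [])" using reach_tail run_Do(5) by (fastforce simp: reach_def)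
  ultimately show ?case using step_Do run_Do by blast
next
  case (run_Seq c m \<sigma> n1 m1 \<sigma>1 d n2 m2 \<sigma>2 n)
  let ?s = "step (tm p acc mi)"
  have k: "c # d # ks \<in> reach p" using reach_succs[OF run_Seq.prems(2)] by simp
  have c: "(None, Seq c d # ks, m) \<in> control p" "(None, c # d # ks, m) \<in> control p"
    using run_Seq.prems k by (simp_all add: control_reach)
  have "tm_trans p acc (index p (None, Seq c d # ks, m)) (map read_tape ts)
      = (index p (None, c # d # ks, m), map (\<lambda>s. (s, Stay)) (map read_tape ts))"
    using tm_trans_index[OF c(1)] c(2) by (simp add: tm_trans_def Let_def number_def)
  from step_idle[OF run_Seq.prems(3) c(1) this, of mi] obtain ts0 where
    0: "tapes_rep \<sigma> ts0" "?s (index p (None, Seq c d # ks, m), ts) = (index p (None, c # d # ks, m), ts0)"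
    by blast
  from run_Seq.IH(1)[OF run_Seq.prems(1) k 0(1)] obtain na ts1 where
    1: "na \<le> n1" "m1 \<in> mems" "tapes_rep \<sigma>1 ts1"
    "(?s ^^ na) (index p (None, c # d # ks, m), ts0) = (index p (None, d # ks, m1), ts1)" by blast
  from run_Seq.IH(2)[OF 1(2) reach_tail[OF k] 1(3)] obtain nb ts2 where
    2: "nb \<le> n2" "m2 \<in> mems" "tapes_rep \<sigma>2 ts2"
    "(?s ^^ nb) (index p (None, d # ks, m1), ts1) = (index p (None, ks, m2), ts2)" by blast
  have "(?s ^^ (nb + na + 1)) (index p (None, Seq c d # ks, m), ts) = (index p (None, ks, m2), ts2)"
    using 0(2) 1(4) 2(4) by (simp add: funpow_add funpow_swap1)
  moreover have "nb + na + 1 \<le> n" using 1(1) 2(1) run_Seq.hyps by simp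
  ultimately show ?case using 2 by blast
next
  case (run_Cond b m \<sigma> c d n1 m1 \<sigma>1 n)
  let ?s = "step (tm p acc mi)" and ?c = "if b m (tops \<sigma>) then c else d"
  have k: "?c # ks \<in> reach p" using reach_succs[OF run_Cond.prems(2)] by simp
  have c: "(None, Cond b c d # ks, m) \<in> control p" "(None, ?c # ks, m) \<in> control p"
    using run_Cond.prems k by (simp_all only: control_reach)
  have "tm_trans p acc (index p (None, Cond b c d # ks, m)) (map read_tape ts)
      = (index p (None, ?c # ks, m), map (\<lambda>s. (s, Stay)) (map read_tape ts))"
    using tm_trans_index[OF c(1)] c(2) tops_eq[OF run_Cond.prems(3)]
    by (simp add: tm_trans_def Let_def number_def)
  from step_idle[OF run_Cond.prems(3) c(1) this, of mi] obtain ts0 where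
    0: "tapes_rep \<sigma> ts0" "?s (index p (None, Cond b c d # ks, m), ts) = (index p (None, ?c # ks, m), ts0)"
    by blast
  from run_Cond.IH[OF run_Cond.prems(1) k 0(1)] obtain na ts1 where
    1: "na \<le> n1" "m1 \<in> mems" "tapes_rep \<sigma>1 ts1"
    "(?s ^^ na) (index p (None, ?c # ks, m), ts0) = (index p (None, ks, m1), ts1)" by blast
  have "(?s ^^ (na + 1)) (index p (None, Cond b c d # ks, m), ts) = (index p (None, ks, m1), ts1)"
    using 0(2) 1(4) by (simp add: funpow_swap1)
  moreover have "na + 1 \<le> n" using 1(1) run_Cond.hyps by simp
  ultimately show ?case using 1 by blast
next
  case (run_While_False b m \<sigma> n c)
  let ?s = "step (tm p acc mi)"
  have k: "ks \<in> reach p" using reach_tail[OF run_While_False.prems(2)] .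
  have c: "(None, While b c # ks, m) \<in> control p" "(None, ks, m) \<in> control p"
    using run_While_False.prems k by (simp_all only: control_reach)
  have "tm_trans p acc (index p (None, While b c # ks, m)) (map read_tape ts)
      = (index p (None, ks, m), map (\<lambda>s. (s, Stay)) (map read_tape ts))"
    using tm_trans_index[OF c(1)] c(2) tops_eq[OF run_While_False.prems(3)] run_While_False.hyps(1)
    by (simp add: tm_trans_def Let_def number_def)
  from step_idle[OF run_While_False.prems(3) c(1) this, of mi] obtain ts0 where
    0: "tapes_rep \<sigma> ts0" "(?s ^^ 1) (index p (None, While b c # ks, m), ts) = (index p (None, ks, m), ts0)"
    by auto
  with run_While_False show ?case by blast
next
  case (run_While_True b m \<sigma> c n1 m1 \<sigma>1 n2 m2 \<sigma>2 n)
  let ?s = "step (tm p acc mi)" and ?w = "While b c"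
  have k: "c # ?w # ks \<in> reach p" using reach_succs[OF run_While_True.prems(2)] by simp
  have c: "(None, ?w # ks, m) \<in> control p" "(None, c # ?w # ks, m) \<in> control p"
    using run_While_True.prems k by (simp_all only: control_reach)
  have "tm_trans p acc (index p (None, ?w # ks, m)) (map read_tape ts)
      = (index p (None, c # ?w # ks, m), map (\<lambda>s. (s, Stay)) (map read_tape ts))"
    using tm_trans_index[OF c(1)] c(2) tops_eq[OF run_While_True.prems(3)] run_While_True.hyps(1)
    by (simp add: tm_trans_def Let_def number_def)
  from step_idle[OF run_While_True.prems(3) c(1) this, of mi] obtain ts0 where
    0: "tapes_rep \<sigma> ts0" "?s (index p (None, ?w # ks, m), ts) = (index p (None, c # ?w # ks, m), ts0)"
    by blast
  from run_While_True.IH(1)[OF run_While_True.prems(1) k 0(1)] obtain na ts1 where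
    1: "na \<le> n1" "m1 \<in> mems" "tapes_rep \<sigma>1 ts1"
    "(?s ^^ na) (index p (None, c # ?w # ks, m), ts0) = (index p (None, ?w # ks, m1), ts1)" by blast
  from run_While_True.IH(2)[OF 1(2) reach_tail[OF k] 1(3)] obtain nb ts2 where
    2: "nb \<le> n2" "m2 \<in> mems" "tapes_rep \<sigma>2 ts2"
    "(?s ^^ nb) (index p (None, ?w # ks, m1), ts1) = (index p (None, ks, m2), ts2)" by blast
  have "(?s ^^ (nb + na + 1)) (index p (None, ?w # ks, m), ts) = (index p (None, ks, m2), ts2)"
    using 0(2) 1(4) 2(4) by (simp add: funpow_add funpow_swap1)
  moreover have "nb + na + 1 \<le> n" using 1(1) 2(1) run_While_True.hyps by simp
  ultimately show ?case using 2 by blast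
qed

definition input_stacks :: "bool list \<Rightarrow> nat \<Rightarrow> nat list" where
  "input_stacks w = (\<lambda>_. [])(0 := map (\<lambda>b. if b then 2 else 1) w)"

lemma tapes_rep_init: "tapes_rep (input_stacks w) (snd (init_config (tm p acc m0) w))"
  using tapes_pos
  by (auto simp: tapes_rep_def init_config_def tm_def input_stacks_def tape_rep_def input_tape_def
      nth_Cons split: nat.splits)

theorem class_P_run:
  assumes m0: "m0 \<in> mems"
    and run: "\<And>w. \<exists>m \<sigma>. run p m0 (input_stacks w) (poly T (length w)) m \<sigma> \<and> (acc m \<longleftrightarrow> w \<in> X)"
  shows "X \<in> class_P"
proof -
  let ?M = "tm p acc m0"
  \<comment> \<open>The additional step leads from the empty continuation to the accepting or
    rejecting state.\<close>
  have "\<exists>t \<le> poly (T + 1) (length w). fst ((step ?M ^^ t) (init_config ?M w)) =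
          (if w \<in> X then accept_state ?M else reject_state ?M)" for w
  proof -
    obtain m \<sigma> where m: "run p m0 (input_stacks w) (poly T (length w)) m \<sigma>" "acc m \<longleftrightarrow> w \<in> X"
      using run by blast
    have k: "[p] \<in> reach p" using conts_self by (auto simp: reach_def)
    have c0: "(None, [p], m0) \<in> control p" using k m0 by (simp add: control_reach)
    from run_tm[OF m(1) m0 k tapes_rep_init, where acc = acc and mi = m0] obtain n ts where
      n: "m \<in> mems" "n \<le> poly T (length w)" "tapes_rep \<sigma> ts"
      "(step ?M ^^ n) (index p (None, [p], m0), snd (init_config ?M w)) = (index p (None, [], m), ts)"
      by blast
    have c: "(None, [], m) \<in> control p" using n(1) by (simp add: control_reach reach_def)
    have init: "init_config ?M w = (index p (None, [p], m0), snd (init_config ?M w))"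
      using c0 by (simp add: init_config_def tm_def number_def)
    have "fst (step ?M (index p (None, [], m), ts)) = (if acc m then accept_state ?M else reject_state ?M)"
      using tm_trans_index[OF c] by (simp add: step_def tm_def tm_trans_def Let_def)
    then have "fst ((step ?M ^^ Suc n) (init_config ?M w))
        = (if w \<in> X then accept_state ?M else reject_state ?M)"
      using m(2) n(4) init by simp
    with n(2) show ?thesis by (intro exI[of _ "Suc n"]) simp
  qed
  then show ?thesis unfolding class_P_def decides_in_time_def using wf_tm by blast
qed

lemma run_mono:
  assumes "run p m \<sigma> n m' \<sigma>'" "n \<le> n'"
  shows "run p m \<sigma> n' m' \<sigma>'"
  using assms by (induction rule: run.induct) (auto intro: run.intros)

lemma run_DoI:
  assumes "g m (tops \<sigma>) = m'" "m' \<in> mems"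
    and "\<And>i a. i < tapes \<Longrightarrow> h m (tops \<sigma>) i = Push a \<Longrightarrow> 0 < a \<and> a < symbols"
    and "\<And>i. perform (h m (tops \<sigma>) i) (\<sigma> i) = \<sigma>' i"
  shows "run (Do g h) m \<sigma> 2 m' \<sigma>'"
proof -
  have "\<sigma>' = (\<lambda>i. perform (h m (tops \<sigma>) i) (\<sigma> i))" using assms(4) by auto
  then show ?thesis using run_Do[of g m \<sigma> h 2] assms by blast
qed

definition move :: "nat \<Rightarrow> nat \<Rightarrow> 'm prog" where
  "move a b = While (\<lambda>_ t. t a \<noteq> 0)
     (Do (\<lambda>m _. m) (\<lambda>_ t. (\<lambda>_. Keep)(a := Pop, b := Push (t a))))"

lemma run_move:
  assumes "a < tapes" "b < tapes" "a \<noteq> b" "m \<in> mems" "set (\<sigma> a) \<subseteq> {0<..<symbols}"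
  shows "run (move a b) m \<sigma> (3 * length (\<sigma> a) + 1) m (\<sigma>(a := [], b := rev (\<sigma> a) @ \<sigma> b))"
  using assms(5)
proof (induction "\<sigma> a" arbitrary: \<sigma>)
  case Nil
  then have eq: "\<sigma>(a := [], b := rev (\<sigma> a) @ \<sigma> b) = \<sigma>" by auto
  show ?case unfolding move_def eq
    using Nil.hyps by (intro run_While_False) (auto simp: tops_def peek_def)
next
  case (Cons s ss)
  let ?\<sigma> = "\<sigma>(a := ss, b := s # \<sigma> b)"
  have s: "0 < s" "s < symbols" using Cons.prems Cons.hyps(2)[symmetric] by auto
  have t: "tops \<sigma> a = s" using assms(1) Cons.hyps(2)[symmetric] by (simp add: tops_def)
  have "run (Do (\<lambda>m _. m) (\<lambda>_ t. (\<lambda>_. Keep)(a := Pop, b := Push (t a)))) m \<sigma> 2 m ?\<sigma>"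
    using assms s t Cons.hyps(2)[symmetric] by (intro run_DoI) (auto split: if_splits)
  moreover have "run (move a b) m ?\<sigma> (3 * length ss + 1) m (?\<sigma>(a := [], b := rev ss @ ?\<sigma> b))"
    using Cons.hyps(1)[of ?\<sigma>] Cons.prems Cons.hyps(2)[symmetric] assms(3) by simp
  moreover have "?\<sigma>(a := [], b := rev ss @ ?\<sigma> b) = \<sigma>(a := [], b := rev (\<sigma> a) @ \<sigma> b)"
    using Cons.hyps(2)[symmetric] assms(3) by auto
  ultimately show ?case
    using run_While_True[of "\<lambda>_ t. t a \<noteq> 0" m \<sigma>] s t Cons.hyps(2)[symmetric]
    unfolding move_def by simp
qed

end

section \<open>Free sets as independent sets of a digraph\<close>

text \<open>Two indices have two partitions. The one into singletons witnesses triviality if both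
  coefficients vanish, the one with a single class if \<open>y = x\<close> and the coefficients
  cancel; these are the two exclusions.\<close>

definition edge :: "int \<Rightarrow> int \<Rightarrow> int \<Rightarrow> int \<Rightarrow> int \<Rightarrow> bool" where
  "edge c1 c2 d y x \<longleftrightarrow>
     c1 * y + c2 * x = d \<and> \<not> (c1 = 0 \<and> c2 = 0) \<and> \<not> (y = x \<and> c1 + c2 = 0)"

lemma trivial_solution_2:
  assumes L: "coeffs \<L> = [c1, c2]"
  shows "trivial_solution \<L> [y, x] \<longleftrightarrow>
     is_solution \<L> [y, x] \<and> (c1 = 0 \<and> c2 = 0 \<or> y = x \<and> c1 + c2 = 0)"
proof -
  have vars: "{..<num_vars \<L>} = {0, 1}" using L by (auto simp: num_vars_def)
  have "(\<exists>P. partition_on {0, 1} P \<and>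
          (\<forall>C\<in>P. (\<forall>i\<in>C. \<forall>j\<in>C. [y, x] ! i = [y, x] ! j) \<and> (\<Sum>i\<in>C. [c1, c2] ! i) = 0))
     \<longleftrightarrow> c1 = 0 \<and> c2 = 0 \<or> y = x \<and> c1 + c2 = 0" (is "(\<exists>P. ?Q P) \<longleftrightarrow> ?R")
  proof
    assume "\<exists>P. ?Q P"
    then obtain P where P: "?Q P" by blast
    then have union: "\<Union>P = {0, 1}" by (simp add: partition_on_def)
    then obtain C D where C: "C \<in> P" "0 \<in> C" and D: "D \<in> P" "1 \<in> D" by blast
    have block: "(\<forall>i\<in>C. \<forall>j\<in>C. [y, x] ! i = [y, x] ! j) \<and> (\<Sum>i\<in>C. [c1, c2] ! i) = 0" if "C \<in> P" for C
      using bspec[OF conjunct2[OF P] that] .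
    have sub: "C \<subseteq> {0, 1}" "D \<subseteq> {0, 1}" using union C D by blast+
    show ?R
    proof (cases "1 \<in> C")
      case True
      then have "C = {0, 1}" using sub C by blast
      moreover have "[y, x] ! 0 = [y, x] ! 1" using block[OF C(1)] C(2) True by blast
      moreover have "(\<Sum>i\<in>C. [c1, c2] ! i) = 0" using block[OF C(1)] by blast
      ultimately show ?thesis by simp
    next
      case False
      then have "C = {0}" using sub C by blast
      moreover have "C \<inter> D = {}"
        using P C D False by (auto simp: partition_on_def disjoint_def)
      then have "D = {1}" using sub C D by blast
      moreover have "(\<Sum>i\<in>C. [c1, c2] ! i) = 0" "(\<Sum>i\<in>D. [c1, c2] ! i) = 0"
        using block[OF C(1)] block[OF D(1)] by blast+
      ultimately show ?thesis by simp
    qed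
  next
    assume ?R
    then show "\<exists>P. ?Q P"
    proof
      assume "c1 = 0 \<and> c2 = 0"
      then have "?Q {{0}, {1}}" by (auto simp: partition_on_def disjoint_def)
      then show ?thesis by blast
    next
      assume "y = x \<and> c1 + c2 = 0"
      then have "?Q {{0, 1}}" by (auto simp: partition_on_def disjoint_def)
      then show ?thesis by blast
    qed
  qed
  then show ?thesis by (simp only: trivial_solution_def vars L)
qed

lemma eq_free_edge:
  assumes L: "coeffs \<L> = [c1, c2]" "rhs \<L> = d"
  shows "eq_free \<L> A \<longleftrightarrow> (\<forall>y\<in>A. \<forall>x\<in>A. \<not> edge c1 c2 d y x)"
proof -
  have sol: "is_solution \<L> [y, x] \<longleftrightarrow> c1 * y + c2 * x = d" for y x
    using L by (simp add: is_solution_def num_vars_def numeral_2_eq_2)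
  have "eq_free \<L> A \<longleftrightarrow>
      (\<forall>y\<in>A. \<forall>x\<in>A. is_solution \<L> [y, x] \<longrightarrow> trivial_solution \<L> [y, x])" (is "_ \<longleftrightarrow> ?R")
  proof
    assume R: ?R
    have "trivial_solution \<L> v" if "set v \<subseteq> A" "is_solution \<L> v" for v
    proof -
      have "length v = Suc (Suc 0)" using that L by (simp add: is_solution_def num_vars_def)
      then obtain y x where "v = [y, x]" by (auto simp: length_Suc_conv)
      with R that show ?thesis by simp
    qed
    then show "eq_free \<L> A" by (auto simp: eq_free_def)
  next
    assume free: "eq_free \<L> A"
    show ?R
    proof (intro ballI impI)
      fix y x assume "y \<in> A" "x \<in> A" "is_solution \<L> [y, x]"
      then show "trivial_solution \<L> [y, x]"
        using free unfolding eq_free_def by (metis empty_set empty_subsetI insert_subset list.simps(15))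
    qed
  qed
  then show ?thesis by (auto simp: trivial_solution_2[OF L(1)] sol edge_def)
qed

section \<open>Kernels of a digraph\<close>

definition admits :: "('a \<Rightarrow> 'a \<Rightarrow> bool) \<Rightarrow> 'a set \<Rightarrow> ('a \<Rightarrow> bool) \<Rightarrow> 'a \<Rightarrow> bool" where
  "admits E A \<beta> x \<longleftrightarrow> \<not> E x x \<and> \<not> (\<exists>y\<in>A - {x}. \<beta> y \<and> E y x)"

definition settled :: "('a \<Rightarrow> 'a \<Rightarrow> bool) \<Rightarrow> 'a set \<Rightarrow> ('a \<Rightarrow> bool) \<Rightarrow> 'a \<Rightarrow> bool" where
  "settled E A \<beta> x \<longleftrightarrow> (\<beta> x \<longleftrightarrow> admits E A \<beta> x)"

definition update :: "('a \<Rightarrow> 'a \<Rightarrow> bool) \<Rightarrow> 'a set \<Rightarrow> ('a \<Rightarrow> bool) \<Rightarrow> 'a \<Rightarrow> 'a \<Rightarrow> bool" where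
  "update E A \<beta> x = \<beta>(x := admits E A \<beta> x)"

text \<open>This is why \<open>admits\<close> treats the loop separately and ranges over
  \<open>A - {x}\<close>: its value at \<open>x\<close> does not depend on the mark of
  \<open>x\<close>, so writing that mark cannot invalidate it.\<close>

lemma settled_update_self: "settled E A (update E A \<beta> x) x"
  by (auto simp: settled_def update_def admits_def)

lemma admits_update: "\<not> E z x \<Longrightarrow> admits E A (update E A \<beta> z) x = admits E A \<beta> x"
  unfolding admits_def[of E A "update E A \<beta> z"] admits_def[of E A \<beta> x] by (auto simp: update_def)

lemma update_settled: "settled E A \<beta> x \<Longrightarrow> update E A \<beta> x = \<beta>"
  by (simp add: settled_def update_def fun_upd_idem)

text \<open>
  A fixed point of the updates is a kernel \<open>K\<close> of the digraph. As every vertex of \<open>K\<close> has at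
  most one successor, an independent set \<open>I\<close> injects into \<open>K\<close> by sending a vertex outside \<open>K\<close>
  to a predecessor in \<open>K\<close>.
\<close>

lemma card_independent_le_kernel:
  assumes fin: "finite A" and settled: "\<And>x. x \<in> A \<Longrightarrow> settled E A \<beta> x"
    and succ: "\<And>y x x'. \<not> E y y \<Longrightarrow> E y x \<Longrightarrow> E y x' \<Longrightarrow> x = x'"
    and I: "I \<subseteq> A" "\<And>y x. y \<in> I \<Longrightarrow> x \<in> I \<Longrightarrow> \<not> E y x"
  shows "card I \<le> card {x \<in> A. \<beta> x}"
proof -
  have "\<exists>y\<in>A. \<beta> y \<and> (if \<beta> x then y = x else E y x)" if "x \<in> I" for x
  proof (cases "\<beta> x")
    case True with that I show ?thesis by auto
  next
    case False
    then have "\<not> admits E A \<beta> x" using settled that I(1) by (auto simp: settled_def)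
    with False I(2)[OF that that] show ?thesis by (auto simp: admits_def)
  qed
  then obtain p where p: "p x \<in> A" "\<beta> (p x)" "if \<beta> x then p x = x else E (p x) x" if "x \<in> I" for x
    by metis
  have loop: "\<not> E (p x) (p x)" if "x \<in> I" for x
  proof -
    have "admits E A \<beta> (p x)" using settled[OF p(1)[OF that]] p(2)[OF that] unfolding settled_def by blast
    then show ?thesis unfolding admits_def by blast
  qed
  have "inj_on p I"
  proof (rule inj_onI)
    fix x x' assume x: "x \<in> I" "x' \<in> I" "p x = p x'"
    show "x = x'"
    proof (cases "\<beta> x = \<beta> x'")
      case True
      then show ?thesis
        using p(3)[OF x(1)] p(3)[OF x(2)] x(3) succ[OF loop[OF x(1)], of x x'] by (simp split: if_splits)
    next
      case False
      then have "E x x' \<or> E x' x" using p(3)[OF x(1)] p(3)[OF x(2)] x(3) by (simp split: if_splits)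
      then show ?thesis using I(2) x by blast
    qed
  qed
  moreover have "p ` I \<subseteq> {x \<in> A. \<beta> x}" using p by auto
  moreover have "finite {x \<in> A. \<beta> x}" using fin by simp
  ultimately show ?thesis by (rule card_inj_on_le)
qed

lemma kernel_independent:
  assumes "\<And>x. x \<in> A \<Longrightarrow> settled E A \<beta> x" "y \<in> A" "x \<in> A" "\<beta> y" "\<beta> x"
  shows "\<not> E y x"
proof -
  have "admits E A \<beta> x" using assms(1)[OF assms(3)] assms(5) unfolding settled_def by blast
  with assms(2,4) show ?thesis unfolding admits_def by blast
qed

section \<open>Convergence of cyclic updates\<close>

locale round_robin =
  fixes E :: "'a \<Rightarrow> 'a \<Rightarrow> bool" and xs :: "'a list" and \<beta> :: "nat \<Rightarrow> 'a \<Rightarrow> bool"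
  assumes step: "xs \<noteq> [] \<Longrightarrow> \<beta> (Suc i) = update E (set xs) (\<beta> i) (xs ! (i mod length xs))"
begin

lemma visited:
  assumes "x \<in> set xs"
  obtains j where "s \<le> j" "j < s + length xs" "xs ! (j mod length xs) = x"
proof -
  have "x \<in> set (rotate s xs)" using assms by simp
  then obtain k where "k < length xs" "rotate s xs ! k = x" by (metis in_set_conv_nth length_rotate)
  then show thesis using that[of "s + k"] by (simp add: nth_rotate)
qed

text \<open>After \<open>r\<close> rounds all vertices of rank below \<open>r\<close> are settled
  for good. The next visit to a vertex \<open>x\<close> of rank \<open>r\<close> settles it, and no
  later update disturbs it: a vertex without an edge to \<open>x\<close> does not matter, and a
  predecessor of \<open>x\<close> has smaller rank, so its update is void. Ranks are smaller than
  the number of vertices.\<close>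

lemma settled_keyed:
  fixes key :: "'a \<Rightarrow> int"
  assumes key: "\<And>y x. y \<in> set xs \<Longrightarrow> x \<in> set xs \<Longrightarrow> y \<noteq> x \<Longrightarrow> E y x \<Longrightarrow> key y < key x"
    and i: "length xs * length xs \<le> i" and x: "x \<in> set xs"
  shows "settled E (set xs) (\<beta> i) x"
proof -
  let ?A = "set xs" and ?n = "length xs"
  define rank where "rank x = card {z \<in> ?A. key z < key x}" for x
  have rank_less: "rank y < rank x" if "y \<in> ?A" "x \<in> ?A" "y \<noteq> x" "E y x" for y x
  proof -
    have "key y < key x" using key that by blast
    then have "{z \<in> ?A. key z < key y} \<subset> {z \<in> ?A. key z < key x}"
      using that by auto
    then show ?thesis unfolding rank_def by (intro psubset_card_mono) auto
  qed
  have main: "settled E ?A (\<beta> i) x" if "r * ?n \<le> i" "x \<in> ?A" "rank x < r" for r i x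
    using that
  proof (induction r arbitrary: i x)
    case (Suc r)
    show ?case
    proof (cases "rank x < r")
      case True
      with Suc show ?thesis by simp
    next
      case False
      with Suc.prems have rx: "rank x = r" by simp
      \<comment> \<open>A visit to \<open>x\<close> among the last \<open>?n\<close> updates before
        \<open>i\<close>. At least \<open>r\<close> full rounds precede it, so that the smaller
        ranks are already settled.\<close>
      obtain j where j: "i - ?n \<le> j" "j < i - ?n + ?n" "xs ! (j mod ?n) = x"
        using visited Suc.prems(2) by blast
      have le: "r * ?n \<le> j" "j < i" using Suc.prems(1) j by auto
      have ne: "xs \<noteq> []" using Suc.prems(2) by auto
      have "settled E ?A (\<beta> k) x" if "Suc j \<le> k" for k
        using that
      proof (induction k rule: dec_induct)
        case base
        then show ?case using round_robin.step[OF round_robin_axioms ne, of j] j(3) settled_update_self by metis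
      next
        case (step k)
        let ?z = "xs ! (k mod ?n)"
        have z: "?z \<in> ?A" using ne by simp
        have eq: "\<beta> (Suc k) = update E ?A (\<beta> k) ?z" by (rule round_robin.step[OF round_robin_axioms ne])
        show ?case
        proof (cases "?z \<noteq> x \<and> E ?z x")
          case True
          then have "rank ?z < r" using rank_less z Suc.prems(2) rx by blast
          then have "settled E ?A (\<beta> k) ?z"
            using Suc.IH[of k ?z] le step(1) z by simp
          then show ?thesis using step.IH eq by (simp add: update_settled)
        next
          case False
          show ?thesis
          proof (cases "?z = x")
            case True
            then show ?thesis using eq settled_update_self by metis
          next
            case zx: False
            then have "admits E ?A (\<beta> (Suc k)) x = admits E ?A (\<beta> k) x" "\<beta> (Suc k) x = \<beta> k x"
              using False admits_update[of E ?z x ?A "\<beta> k"] unfolding eq by (simp_all add: update_def)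
            then show ?thesis using step.IH by (simp add: settled_def)
          qed
        qed
      qed
      with le show ?thesis by simp
    qed
  qed simp
  have "rank x < ?n"
  proof -
    have "{z \<in> ?A. key z < key x} \<subset> ?A" using x by auto
    then have "rank x < card ?A" unfolding rank_def by (intro psubset_card_mono) auto
    then show ?thesis using card_length[of xs] by simp
  qed
  with main i x show ?thesis by blast
qed

text \<open>A vertex stays settled from its first visit on. Only an update of its unique neighbour
  \<open>?z\<close> could matter; but \<open>?z\<close> then receives the opposite of the mark of
  \<open>x\<close>, which is exactly what justifies the mark of \<open>x\<close>. Uniqueness also
  excludes loops at either end of such an edge.\<close>

lemma settled_symmetric:
  assumes sym: "\<And>y x. E y x \<Longrightarrow> E x y"
    and pred: "\<And>y z x. E y x \<Longrightarrow> E z x \<Longrightarrow> y = z"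
    and i: "length xs * length xs \<le> i" and x: "x \<in> set xs"
  shows "settled E (set xs) (\<beta> i) x"
proof -
  let ?A = "set xs" and ?n = "length xs"
  obtain j where j: "j < ?n" "xs ! (j mod ?n) = x" using visited[OF x, of 0] by auto
  have ne: "xs \<noteq> []" using x by auto
  have "settled E ?A (\<beta> k) x" if "Suc j \<le> k" for k
    using that
  proof (induction k rule: dec_induct)
    case base
    then show ?case using round_robin.step[OF round_robin_axioms ne, of j] j(2) settled_update_self by metis
  next
    case (step k)
    let ?z = "xs ! (k mod ?n)"
    have z: "?z \<in> ?A" using ne by simp
    have eq: "\<beta> (Suc k) = update E ?A (\<beta> k) ?z" by (rule round_robin.step[OF round_robin_axioms ne])
    show ?case
    proof (cases "?z = x")
      case True
      then show ?thesis using eq settled_update_self by metis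
    next
      case zx: False
      then have same: "\<beta> (Suc k) x = \<beta> k x" by (simp add: eq update_def)
      have other: "admits E ?A (\<beta> (Suc k)) x = admits E ?A (\<beta> k) x" if "\<not> E ?z x"
        unfolding eq using that by (rule admits_update)
      have "admits E ?A (\<beta> (Suc k)) x = admits E ?A (\<beta> k) x" if Ezx: "E ?z x"
      proof -
        have Exz: "E x ?z" using sym Ezx by blast
        have nx: "\<not> E x x" using pred[OF _ Ezx] zx by blast
        have nz: "\<not> E ?z ?z" using pred[OF _ Exz] zx by blast
        have "\<not> admits E ?A (\<beta> (Suc k)) x \<longleftrightarrow> \<beta> (Suc k) ?z"
          unfolding admits_def using nx pred[OF _ Ezx] Ezx z zx by blast
        also have "\<dots> \<longleftrightarrow> admits E ?A (\<beta> k) ?z" by (simp add: eq update_def)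
        also have "\<dots> \<longleftrightarrow> \<not> \<beta> k x"
          unfolding admits_def using nz pred[OF _ Exz] Exz x zx by blast
        also have "\<dots> \<longleftrightarrow> \<not> admits E ?A (\<beta> k) x" using step.IH by (simp add: settled_def)
        finally show ?thesis by blast
      qed
      with other same step.IH show ?thesis unfolding settled_def by blast
    qed
  qed
  moreover have "?n \<le> ?n * ?n" by (rule le_square)
  then have "Suc j \<le> i" using i j(1) by linarith
  ultimately show ?thesis by blast
qed

end

text \<open>
  With \<open>u = (c1 + c2) y - d\<close> and \<open>v = (c1 + c2) x - d\<close> the equation for \<open>(y, x)\<close> gives
  \<open>c1 u + c2 v = 0\<close>. Hence edges increase or decrease this quantity in absolute value, unless
  \<open>\<bar>c1\<bar> = \<bar>c2\<bar>\<close>.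
\<close>

lemma edge_key:
  assumes ne: "c1 \<noteq> c2 \<or> c1 = 0"
  obtains key :: "int \<Rightarrow> int" where "\<And>y x. y \<noteq> x \<Longrightarrow> edge c1 c2 d y x \<Longrightarrow> key y < key x"
proof -
  define t where "t x = (c1 + c2) * x - d" for x
  have t: "\<bar>c1\<bar> * \<bar>t y\<bar> = \<bar>c2\<bar> * \<bar>t x\<bar>" if "edge c1 c2 d y x" for y x
  proof -
    have "c1 * t y + c2 * t x = (c1 + c2) * (c1 * y + c2 * x) - (c1 + c2) * d"
      by (simp add: t_def algebra_simps)
    also have "\<dots> = 0" using that by (simp add: edge_def)
    finally have "c1 * t y = - (c2 * t x)" by simp
    then show ?thesis by (metis abs_minus abs_mult)
  qed
  \<comment> \<open>This excludes that both \<open>t y\<close> and \<open>t x\<close> vanish for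
    distinct \<open>x\<close> and \<open>y\<close>; \<open>c1 + c2\<close> is non-zero whenever the
    absolute values of the coefficients differ.\<close>
  have inj: "x = y" if "t x = t y" "c1 + c2 \<noteq> 0" for x y using that by (simp add: t_def)
  have less: "a < b" if "p * a = q * b" "q < p" "0 \<le> a" "0 \<le> b" "0 \<le> q" "a \<noteq> 0 \<or> b \<noteq> 0" for p q a b :: int
  proof (rule ccontr)
    assume "\<not> a < b"
    then have "q * b \<le> q * a" using \<open>0 \<le> q\<close> by (simp add: mult_left_mono)
    moreover have "0 < a" using that \<open>\<not> a < b\<close> by auto
    then have "q * a < p * a" using \<open>q < p\<close> by (rule mult_strict_right_mono[rotated])
    ultimately show False using that by simp
  qed
  consider "\<bar>c1\<bar> > \<bar>c2\<bar>" | "\<bar>c1\<bar> < \<bar>c2\<bar>" | "c1 = - c2" using ne by linarith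
  then show thesis
  proof cases
    case 1
    have "\<bar>t y\<bar> < \<bar>t x\<bar>" if "y \<noteq> x" "edge c1 c2 d y x" for y x
      using less[OF t[OF that(2)] 1] inj[of x y] that(1) 1 by fastforce
    then show thesis by (rule that)
  next
    case 2
    have "- \<bar>t y\<bar> < - \<bar>t x\<bar>" if "y \<noteq> x" "edge c1 c2 d y x" for y x
      using less[OF t[OF that(2), symmetric] 2] inj[of x y] that(1) 2 by fastforce
    then show thesis by (rule that)
  next
    case 3
    \<comment> \<open>Here an edge means \<open>c1 * (y - x) = d\<close>, a translation. Multiplying
      by \<open>c1 * d\<close> makes the direction independent of signs: along every edge the key
      grows by \<open>d * d\<close>.\<close>
    have "- (c1 * d * y) < - (c1 * d * x)" if "y \<noteq> x" "edge c1 c2 d y x" for y x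
    proof -
      have d: "d = c1 * (y - x)" and c1: "c1 \<noteq> 0"
        using that 3 by (auto simp: edge_def algebra_simps)
      then have "d \<noteq> 0" using that by simp
      moreover have "c1 * d * y - c1 * d * x = d * (c1 * (y - x))" by (simp add: algebra_simps)
      then have "c1 * d * y - c1 * d * x = d * d" using d by simp
      ultimately show ?thesis using not_real_square_gt_zero[of d] by (smt (verit) mult_pos_pos mult_neg_neg)
    qed
    then show thesis by (rule that)
  qed
qed

section \<open>Updates as rotations of a list of marked numbers\<close>

definition rotate_mark :: "('a \<Rightarrow> 'a \<Rightarrow> bool) \<Rightarrow> (bool \<times> 'a) list \<Rightarrow> (bool \<times> 'a) list" where
  "rotate_mark E es = (case es of [] \<Rightarrow> []
     | (b, x) # r \<Rightarrow> r @ [(\<not> E x x \<and> \<not> (\<exists>(a, y)\<in>set r. a \<and> E y x), x)])"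

lemma rotate_mark_simps [simp]:
  "rotate_mark E [] = []"
  "rotate_mark E ((b, x) # r) = r @ [(\<not> E x x \<and> \<not> (\<exists>(a, y)\<in>set r. a \<and> E y x), x)]"
  by (simp_all add: rotate_mark_def)

lemma rotate_mark_snd: "map snd (rotate_mark E es) = rotate1 (map snd es)"
  by (auto simp: rotate_mark_def split: list.splits)

lemma rotate_mark_iter_snd: "map snd ((rotate_mark E ^^ n) es) = rotate n (map snd es)"
  by (induction n) (auto simp: rotate_mark_snd)

fun marking :: "('a \<Rightarrow> 'a \<Rightarrow> bool) \<Rightarrow> 'a list \<Rightarrow> nat \<Rightarrow> 'a \<Rightarrow> bool" where
  "marking E xs 0 = (\<lambda>_. False)"
| "marking E xs (Suc i) = update E (set xs) (marking E xs i) (xs ! (i mod length xs))"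

text \<open>Rotation turns the cyclic access of \<open>round_robin\<close> into access to the front
  of the list. Distinctness ensures that the entries behind the front are precisely
  \<open>A - {x}\<close>, the range of \<open>admits\<close>.\<close>

lemma rotate_mark_marking:
  assumes "distinct xs"
  shows "(rotate_mark E ^^ n) (map (Pair False) xs) = map (\<lambda>x. (marking E xs n x, x)) (rotate n xs)"
proof (induction n)
  case (Suc n)
  show ?case
  proof (cases "rotate n xs")
    case Nil
    with Suc show ?thesis by simp
  next
    case (Cons x r)
    then have "xs \<noteq> []" by auto
    then have x: "xs ! (n mod length xs) = x"
      using Cons hd_rotate_conv_nth by (metis list.sel(1))
    have "distinct (x # r)" "set (x # r) = set xs"
      using assms Cons by (metis distinct_rotate, metis set_rotate)
    then have r: "set xs - {x} = set r" "x \<notin> set r" by auto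
    show ?thesis using Suc Cons x r(2)
      by (auto simp: update_def admits_def r(1) fun_upd_def)
  qed
qed simp

lemma has_free_subset_marking:
  assumes L: "coeffs \<L> = [c1, c2]" "rhs \<L> = d"
    and xs: "distinct xs" and n: "length xs * length xs \<le> n"
  shows "has_free_subset \<L> (set xs) k \<longleftrightarrow>
     k \<le> length (filter fst ((rotate_mark (edge c1 c2 d) ^^ n) (map (Pair False) xs)))"
proof -
  let ?E = "edge c1 c2 d" and ?A = "set xs"
  let ?\<beta> = "marking ?E xs n" and ?K = "{x \<in> set xs. marking (edge c1 c2 d) xs n x}"
  interpret round_robin ?E xs "marking ?E xs" by unfold_locales simp
  have settled: "settled ?E ?A ?\<beta> x" if "x \<in> ?A" for x
  proof (cases "c1 \<noteq> c2 \<or> c1 = 0")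
    case True
    then obtain key where "\<And>y x. y \<noteq> x \<Longrightarrow> ?E y x \<Longrightarrow> key y < (key x :: int)" using edge_key[of c1 c2 d] by blast
    with settled_keyed n that show ?thesis by blast
  next
    case False
    then show ?thesis
      by (intro settled_symmetric[OF _ _ n that]) (auto simp: edge_def algebra_simps)
  qed
  \<comment> \<open>For \<open>c2 = 0\<close> the equation does not involve \<open>x\<close>, so a
    vertex with any successor also has a loop; otherwise \<open>y\<close> determines
    \<open>x\<close>.\<close>
  have succ: "x = x'" if "\<not> ?E y y" "?E y x" "?E y x'" for y x x'
    using that by (cases "c2 = 0") (auto simp: edge_def)
  have "card I \<le> card ?K" if "I \<subseteq> ?A" "eq_free \<L> I" for I
  proof (rule card_independent_le_kernel[OF finite_set settled _ that(1)])
    show "\<not> ?E y x" if "y \<in> I" "x \<in> I" for y x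
      using that \<open>eq_free \<L> I\<close> unfolding eq_free_edge[OF L] by blast
  qed (auto dest: succ)
  moreover have free: "eq_free \<L> I" if "I \<subseteq> ?K" for I
    unfolding eq_free_edge[OF L] using that kernel_independent[of ?A ?E ?\<beta>, OF settled] by blast
  \<comment> \<open>Subsets of the kernel are free as well, so every size up to the maximum
    occurs.\<close>
  have "has_free_subset \<L> ?A k" if k: "k \<le> card ?K"
  proof -
    obtain I where "I \<subseteq> ?K" "card I = k" using obtain_subset_with_card_n[OF k] by blast
    with free show ?thesis unfolding has_free_subset_def by blast
  qed
  ultimately have "has_free_subset \<L> ?A k \<longleftrightarrow> k \<le> card ?K"
    by (auto simp: has_free_subset_def)
  moreover have "card ?K = length (filter ?\<beta> (rotate n xs))"
    using xs distinct_card[of "filter ?\<beta> (rotate n xs)"] by simp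
  moreover have "\<dots> = length (filter fst (map (\<lambda>x. (?\<beta> x, x)) (rotate n xs)))"
    by (simp add: filter_map comp_def)
  ultimately show ?thesis using rotate_mark_marking[OF xs] by simp
qed

text \<open>This lets the scans detect repetitions: if the entries at \<open>j < k\<close> agree,
  the rotation by \<open>j\<close> puts one of them in front while the other is among the
  rest.\<close>

lemma distinct_rotate_iff:
  assumes "length xs \<le> n"
  shows "distinct xs \<longleftrightarrow> (\<forall>i<n. \<forall>x r. rotate i xs = x # r \<longrightarrow> x \<notin> set r)"
proof
  assume "distinct xs"
  then show "\<forall>i<n. \<forall>x r. rotate i xs = x # r \<longrightarrow> x \<notin> set r"
    by (metis distinct.simps(2) distinct_rotate)
next
  assume R: "\<forall>i<n. \<forall>x r. rotate i xs = x # r \<longrightarrow> x \<notin> set r"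
  show "distinct xs"
  proof (rule ccontr)
    assume "\<not> distinct xs"
    then obtain j k where jk: "j < length xs" "k < length xs" "j < k" "xs ! j = xs ! k"
      unfolding distinct_conv_nth by (metis nat_neq_iff)
    have "rotate j xs = xs ! j # (drop (Suc j) xs @ take j xs)"
      using jk by (simp add: rotate_drop_take Cons_nth_drop_Suc[symmetric])
    moreover have "xs ! j \<in> set (drop (Suc j) xs)"
      using jk by (auto simp: in_set_conv_nth intro!: exI[of _ "k - Suc j"])
    ultimately show False using R jk assms by (metis Un_iff less_le_trans set_append)
  qed
qed

section \<open>Numbers and instances as words\<close>

fun bval :: "bool list \<Rightarrow> nat" where
  "bval [] = 0"
| "bval (b # bs) = of_bool b + 2 * bval bs"

lemma bval_binary [simp]: "bval (binary n) = n"
proof (induction n rule: binary.induct)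
  case (1 n)
  then show ?case by (subst binary.simps) (auto simp: odd_two_times_div_two_succ)
qed

lemma binary_eq_iff: "binary m = binary n \<longleftrightarrow> m = n"
  by (metis bval_binary)

lemma binary_last: "binary n \<noteq> [] \<Longrightarrow> last (binary n)"
proof (induction n rule: binary.induct)
  case (1 n)
  show ?case
  proof (cases "n div 2 = 0")
    case True
    with 1(2) have "n = 1" by (subst (asm) binary.simps) (auto split: if_splits)
    then show ?thesis by (simp add: binary.simps)
  next
    case False
    then have "n \<noteq> 0" "binary (n div 2) \<noteq> []" by (auto simp: binary.simps[of "n div 2"])
    with 1(1) show ?thesis by (subst binary.simps) simp
  qed
qed

lemma bval_pos: "bs \<noteq> [] \<Longrightarrow> last bs \<Longrightarrow> 0 < bval bs"
  by (induction bs) (auto split: if_splits)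

lemma binary_bval: "bs = [] \<or> last bs \<Longrightarrow> binary (bval bs) = bs"
proof (induction bs)
  case Nil
  then show ?case by (simp add: binary.simps)
next
  case (Cons b bs)
  have "0 < bval (b # bs)" using Cons.prems by (intro bval_pos) auto
  moreover have "binary (bval bs) = bs" using Cons by (auto split: if_splits)
  ultimately show ?case by (subst binary.simps) (auto split: if_splits)
qed

section \<open>The language of instance encodings\<close>

text \<open>
  States of the recognizer of instances: in the first number, \<open>0\<close> if it may end here and \<open>1\<close> if
  not; \<open>2\<close> before a further number; within one, \<open>4\<close> if it may end here and \<open>3\<close> if not;
  \<open>5\<close> after an error.
\<close>

fun dfa :: "nat \<Rightarrow> letter \<Rightarrow> nat" where
  "dfa s (Digit b) = (if s < 2 then if b then 0 else 1 else if s = 5 then 5 else if b then 4 else 3)"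
| "dfa s Minus = (if s = 2 then 3 else 5)"
| "dfa s Sep = (if s \<in> {0, 2, 4} then 2 else 5)"

lemma dfa_le: "dfa s l \<le> 5"
  by (cases l) auto

lemma dfa_ge: "2 \<le> s \<Longrightarrow> 2 \<le> dfa s l"
  by (cases l) auto

lemma dfa_error: "foldl dfa 5 ls = 5"
proof (induction ls)
  case (Cons l ls)
  then show ?case by (cases l) auto
qed simp

lemma dfa_digits_first:
  "s < 2 \<Longrightarrow> foldl dfa s (map Digit bs) = (if bs = [] then s else if last bs then 0 else 1)"
  by (induction bs arbitrary: s) auto

lemma dfa_digits:
  "2 \<le> s \<Longrightarrow> s < 5 \<Longrightarrow>
     foldl dfa s (map Digit bs) = (if bs = [] then s else if last bs then 4 else 3)"
  by (induction bs arbitrary: s) auto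

lemma dfa_nat_letters: "foldl dfa 0 (nat_letters n) = 2"
  using binary_last[of n] by (auto simp: nat_letters_def dfa_digits_first)

lemma dfa_int_letters: "foldl dfa 2 (int_letters x) = 2"
proof -
  have "binary (nat \<bar>x\<bar>) \<noteq> []" if "x < 0" using that by (subst binary.simps) auto
  then show ?thesis
    using binary_last[of "nat \<bar>x\<bar>"] by (auto simp: int_letters_def nat_letters_def dfa_digits)
qed

lemma dfa_ints: "foldl dfa 2 (concat (map int_letters xs)) = 2"
  by (induction xs) (auto simp: dfa_int_letters)

lemma split_digits:
  obtains bs where "ls = map Digit bs" | bs ls' where "ls = map Digit bs @ Minus # ls'"
  | bs ls' where "ls = map Digit bs @ Sep # ls'"
proof (induction ls arbitrary: thesis)
  case Nil
  then show ?case by simp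
next
  case (Cons l ls)
  show ?case
  proof (cases l)
    case (Digit b)
    show ?thesis
    proof (rule Cons.IH)
      fix bs assume "ls = map Digit bs"
      then show thesis using Cons.prems(1)[of "b # bs"] Digit by simp
    next
      fix bs ls' assume "ls = map Digit bs @ Minus # ls'"
      then show thesis using Cons.prems(2)[of "b # bs" ls'] Digit by simp
    next
      fix bs ls' assume "ls = map Digit bs @ Sep # ls'"
      then show thesis using Cons.prems(3)[of "b # bs" ls'] Digit by simp
    qed
  next
    case Minus
    then show ?thesis using Cons.prems(2)[of "[]" ls] by simp
  next
    case Sep
    then show ?thesis using Cons.prems(3)[of "[]" ls] by simp
  qed
qed

lemma dfa_ints_complete: "foldl dfa 2 ls = 2 \<Longrightarrow> \<exists>xs. ls = concat (map int_letters xs)"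
proof (induction ls rule: length_induct)
  case (1 ls)
  have number: "\<exists>xs. ls = concat (map int_letters xs)"
    if ls: "ls = (if neg then [Minus] else []) @ map Digit bs @ Sep # ls'"
      and neg: "neg \<longrightarrow> bs \<noteq> []" and last: "bs = [] \<or> last bs" and acc: "foldl dfa 2 ls' = 2" for neg bs ls'
  proof -
    obtain xs where "ls' = concat (map int_letters xs)" using 1 ls acc by fastforce
    moreover have "int_letters (if neg then - int (bval bs) else int (bval bs))
        = (if neg then [Minus] else []) @ map Digit bs @ [Sep]"
      using neg last bval_pos[of bs] by (auto simp: int_letters_def nat_letters_def binary_bval)
    ultimately have "ls = concat (map int_letters ((if neg then - int (bval bs) else int (bval bs)) # xs))"
      using ls by simp
    then show ?thesis by blast
  qed
  show ?case
  proof (cases ls)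
    case Nil
    then show ?thesis by (intro exI[of _ "[]"]) simp
  next
    case (Cons l ls0)
    define neg where "neg \<longleftrightarrow> l = Minus"
    define rest where "rest = (if neg then ls0 else ls)"
    define s :: nat where "s = (if neg then 3 else 2)"
    have ls: "ls = (if neg then [Minus] else []) @ rest" using Cons by (auto simp: rest_def neg_def)
    have acc: "foldl dfa s rest = 2" using 1(2) Cons by (auto simp: rest_def s_def neg_def)
    have s: "2 \<le> s" "s < 5" by (auto simp: s_def)
    show ?thesis
    proof (rule split_digits[of rest])
      fix bs assume "rest = map Digit bs"
      then have "bs = []" "s = 2" using acc dfa_digits[OF s, of bs] by (auto split: if_splits)
      then show ?thesis using \<open>rest = map Digit bs\<close> Cons by (auto simp: rest_def s_def split: if_splits)
    next
      fix bs ls' assume r: "rest = map Digit bs @ Minus # ls'"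
      then have "foldl dfa s (map Digit bs) = 2"
        using acc by (auto simp: dfa_error split: if_splits)
      then have "bs = []" "s = 2" using dfa_digits[OF s, of bs] by (auto split: if_splits)
      then show ?thesis using r Cons by (auto simp: rest_def s_def neg_def split: if_splits)
    next
      fix bs ls' assume r: "rest = map Digit bs @ Sep # ls'"
      then have e: "foldl dfa s (map Digit bs) \<in> {0, 2, 4}" "foldl dfa 2 ls' = 2"
        using acc by (auto simp: dfa_error split: if_splits)
      then show ?thesis using number[of neg bs ls'] ls r dfa_digits[OF s, of bs]
        by (auto simp: s_def split: if_splits)
    qed
  qed
qed

lemma dfa_complete:
  assumes "foldl dfa 0 ls = 2"
  shows "\<exists>k xs. ls = nat_letters k @ concat (map int_letters xs)"
proof (rule split_digits[of ls])
  fix bs assume "ls = map Digit bs"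
  then show ?thesis using assms dfa_digits_first[of 0 bs] by (auto split: if_splits)
next
  fix bs ls' assume "ls = map Digit bs @ Minus # ls'"
  then show ?thesis using assms dfa_digits_first[of 0 bs] by (auto simp: dfa_error split: if_splits)
next
  fix bs ls' assume ls: "ls = map Digit bs @ Sep # ls'"
  then have e: "bs = [] \<or> last bs" "foldl dfa 2 ls' = 2"
    using assms dfa_digits_first[of 0 bs] by (auto simp: dfa_error split: if_splits)
  then obtain xs where "ls' = concat (map int_letters xs)" using dfa_ints_complete by blast
  with ls e have "ls = nat_letters (bval bs) @ concat (map int_letters xs)"
    by (simp add: nat_letters_def binary_bval)
  then show ?thesis by blast
qed

lemma length_letters: "length (concat (map letter_bits ls)) = 2 * length ls"
proof (induction ls)
  case (Cons l ls)
  then show ?case by (cases l) auto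
qed simp

fun letter_of :: "bool \<Rightarrow> bool \<Rightarrow> letter" where
  "letter_of False b = Digit b"
| "letter_of True False = Minus"
| "letter_of True True = Sep"

lemma letter_bits_letter_of: "letter_bits (letter_of a b) = [a, b]"
  by (cases a; cases b) auto

lemma letter_bits_cases: obtains a b where "letter_bits l = [a, b]" "letter_of a b = l"
  by (cases l) auto

lemma bits_letters:
  obtains ls r where "w = concat (map letter_bits ls) @ r" "length r \<le> 1"
proof (induction w arbitrary: thesis rule: induct_list012)
  case 1
  then show ?case using 1[of "[]" "[]"] by simp
next
  case (2 a)
  then show ?case using 2[of "[]" "[a]"] by simp
next
  case (3 a b w)
  show ?case
  proof (rule 3(1))
    fix ls r assume "w = concat (map letter_bits ls) @ r" "length r \<le> 1"
    then show thesis using 3(3)[of "letter_of a b # ls" r] by (simp add: letter_bits_letter_of)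
  qed
qed

section \<open>Linear equations evaluated by a carry automaton\<close>

text \<open>
  Evaluation of \<open>s + u a + v b\<close> for numbers \<open>a\<close> and \<open>b\<close> given by their digits: the carry is halved
  at every position, and \<open>None\<close> records that an odd digit occurred, so that the value is not \<open>0\<close>.
\<close>

definition cstep :: "int \<Rightarrow> int \<Rightarrow> bool \<Rightarrow> bool \<Rightarrow> int option \<Rightarrow> int option" where
  "cstep u v a b r = (case r of None \<Rightarrow> None
     | Some s \<Rightarrow> let t = s + u * of_bool a + v * of_bool b in if even t then Some (t div 2) else None)"

fun cfold :: "int \<Rightarrow> int \<Rightarrow> bool list \<Rightarrow> bool list \<Rightarrow> int option \<Rightarrow> int option" where
  "cfold u v [] [] r = r"
| "cfold u v (a # as) [] r = cfold u v as [] (cstep u v a False r)"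
| "cfold u v [] (b # bs) r = cfold u v [] bs (cstep u v False b r)"
| "cfold u v (a # as) (b # bs) r = cfold u v as bs (cstep u v a b r)"

lemma cstep_None [simp]: "cstep u v a b None = None"
  by (simp add: cstep_def)

lemma cfold_None [simp]: "cfold u v as bs None = None"
  by (induction u v as bs "None :: int option" rule: cfold.induct) auto

lemma cfold_cstep:
  assumes "\<And>s. cfold u v as bs (Some s) = Some 0 \<longleftrightarrow> s + u * bval as + v * bval bs = 0"
  shows "cfold u v as bs (cstep u v a b (Some s)) = Some 0 \<longleftrightarrow>
     s + u * (of_bool a + 2 * bval as) + v * (of_bool b + 2 * bval bs) = 0"
proof (cases "even (s + u * of_bool a + v * of_bool b)")
  case True
  then obtain q where q: "s + u * of_bool a + v * of_bool b = 2 * q" by blast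
  then have "cstep u v a b (Some s) = Some q" by (simp add: cstep_def)
  moreover have "s + u * (of_bool a + 2 * bval as) + v * (of_bool b + 2 * bval bs)
      = 2 * (q + u * bval as + v * bval bs)"
    using q by (simp add: algebra_simps)
  ultimately show ?thesis using assms[of q] by (simp only: mult_eq_0_iff) simp
next
  case False
  have eq: "s + u * (of_bool a + 2 * bval as) + v * (of_bool b + 2 * bval bs)
      = (s + u * of_bool a + v * of_bool b) + 2 * (u * bval as + v * bval bs)"
    by (simp add: algebra_simps)
  then have "odd (s + u * (of_bool a + 2 * bval as) + v * (of_bool b + 2 * bval bs))"
    using False by (simp only: eq) simp
  then have "s + u * (of_bool a + 2 * bval as) + v * (of_bool b + 2 * bval bs) \<noteq> 0"
    by (metis dvd_0_right)
  with False show ?thesis by (simp add: cstep_def)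
qed

lemma cfold_zero: "cfold u v as bs (Some s) = Some 0 \<longleftrightarrow> s + u * bval as + v * bval bs = 0"
proof (induction "length as + length bs" arbitrary: as bs s rule: less_induct)
  case less
  show ?case
  proof (cases as; cases bs)
    fix a as' assume "as = a # as'" "bs = []"
    then show ?thesis using cfold_cstep[of u v as' "[]" a False s] less[of as' "[]"] by simp
  next
    fix b bs' assume "as = []" "bs = b # bs'"
    then show ?thesis using cfold_cstep[of u v "[]" bs' False b s] less[of "[]" bs'] by simp
  next
    fix a as' b bs' assume "as = a # as'" "bs = b # bs'"
    then show ?thesis using cfold_cstep[of u v as' bs' a b s] less[of as' bs'] by simp
  qed auto
qed

definition carry_le :: "int \<Rightarrow> int option \<Rightarrow> bool" where
  "carry_le B r \<longleftrightarrow> (\<forall>s. r = Some s \<longrightarrow> \<bar>s\<bar> \<le> B)"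

text \<open>The value that gets halved is at most \<open>2 * B\<close> in absolute value, so the
  range of carries is closed under steps. Thus the evaluation is done by a finite automaton.\<close>

lemma carry_le_cstep:
  assumes "carry_le B r" "\<bar>u\<bar> + \<bar>v\<bar> \<le> B"
  shows "carry_le B (cstep u v a b r)"
proof (cases r)
  case (Some s)
  define t where "t = s + u * of_bool a + v * of_bool b"
  have "\<bar>s\<bar> \<le> B" using assms Some by (simp add: carry_le_def)
  then have "\<bar>t\<bar> \<le> 2 * B" using assms(2) by (auto simp: t_def)
  then have "\<bar>t div 2\<bar> \<le> B" by linarith
  then show ?thesis using Some by (simp add: cstep_def carry_le_def t_def Let_def)
qed (simp add: carry_le_def)

text \<open>Truncated at the length of the argument, so that \<open>0\<close> is turned into \<open>2 ^ length bs - 1\<close>.\<close>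

fun dec :: "bool list \<Rightarrow> bool list" where
  "dec [] = []"
| "dec (True # bs) = False # bs"
| "dec (False # bs) = True # dec bs"

lemma length_dec [simp]: "length (dec bs) = length bs"
  by (induction bs rule: dec.induct) auto

lemma bval_dec: "0 < bval bs \<Longrightarrow> bval (dec bs) = bval bs - 1"
  by (induction bs rule: dec.induct) auto

definition countdown :: "bool list \<times> bool \<Rightarrow> bool list \<times> bool" where
  "countdown = (\<lambda>(bs, u). (dec bs, u \<or> bval bs = 0))"

text \<open>The digits are tracked only up to the first underflow; from then on the flag persists
  and the wrapped value is irrelevant.\<close>

lemma countdown_iter:
  "snd ((countdown ^^ j) (bs, False)) \<longleftrightarrow> bval bs < j"
proof -
  have "(snd ((countdown ^^ j) (bs, False)) \<longleftrightarrow> bval bs < j) \<and>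
      (j \<le> bval bs \<longrightarrow> bval (fst ((countdown ^^ j) (bs, False))) = bval bs - j)"
  proof (induction j)
    case (Suc j)
    then show ?case
      by (cases "(countdown ^^ j) (bs, False)") (auto simp: countdown_def bval_dec)
  qed simp
  then show ?thesis by blast
qed

section \<open>The program\<close>

text \<open>\<open>st\<close> and \<open>half\<close> serve the recognizer, \<open>half\<close>
  being the first bit of an unfinished letter. \<open>same\<close> records that the two numbers
  under comparison agree so far, \<open>hit\<close> that the current number has a loop or a marked
  predecessor. \<open>dup\<close> (a repeated element) and \<open>under\<close> (underflow of the
  counter) decide the answer.\<close>

record memory =
  st :: nat
  half :: "bool option"
  negx :: bool
  negy :: bool
  carry :: "int option"
  same :: bool
  hit :: bool
  dup :: bool
  under :: bool

locale two_var =
  fixes c1 c2 d :: int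
begin

text \<open>The carry starts with \<open>- d\<close>, and a bound of at least
  \<open>|c1| + |c2|\<close> is preserved by the steps, whatever the signs of the numbers.
  \<open>5\<close> is the largest state of \<open>dfa\<close>.\<close>

definition mems :: "memory set" where
  "mems = {m. st m \<le> 5 \<and> carry_le (\<bar>c1\<bar> + \<bar>c2\<bar> + \<bar>d\<bar>) (carry m)}"

lemma finite_mems: "finite mems"
proof -
  let ?B = "\<bar>c1\<bar> + \<bar>c2\<bar> + \<bar>d\<bar>"
  let ?S = "{..5} \<times> UNIV \<times> UNIV \<times> UNIV \<times> insert None (Some ` {- ?B..?B}) \<times> UNIV \<times> UNIV \<times> UNIV \<times> UNIV
    :: (nat \<times> bool option \<times> bool \<times> bool \<times> int option \<times> bool \<times> bool \<times> bool \<times> bool) set"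
  let ?f = "\<lambda>m. (st m, half m, negx m, negy m, carry m, same m, hit m, dup m, under m)"
  have "inj_on ?f mems" by (rule inj_onI) (auto intro!: memory.equality)
  moreover have "?f ` mems \<subseteq> ?S"
  proof -
    have "carry m \<in> insert None (Some ` {- ?B..?B})" if "m \<in> mems" for m
      using that by (cases "carry m") (auto simp: mems_def carry_le_def abs_le_iff)
    then show ?thesis by (auto simp: mems_def)
  qed
  moreover have "finite ?S" by simp
  ultimately show ?thesis by (meson finite_imageD finite_subset)
qed

sublocale stack_machine 11 6 mems
  by unfold_locales (simp_all add: finite_mems)

lemma tops_less [simp]: "i < 11 \<Longrightarrow> tops \<sigma> i = peek (\<sigma> i)"
  by (simp add: tops_def)

end

text \<open>
  The symbols \<open>1\<close> and \<open>2\<close> are digits and \<open>3\<close> is the sign. An entry of the list of numbers ends with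
  \<open>5\<close> if the number is marked and with \<open>4\<close> if not.
\<close>

definition dsym :: "bool \<Rightarrow> nat" where
  "dsym b = (if b then 2 else 1)"

lemma dsym_simps [simp]: "dsym b = 2 \<longleftrightarrow> b" "dsym b = Suc 0 \<longleftrightarrow> \<not> b" "dsym b \<noteq> 0" "0 < dsym b" "dsym b < 6"
  "dsym b = 1 \<or> dsym b = 2" "dsym b \<noteq> 3" "dsym b \<noteq> 4" "dsym b \<noteq> 5"
  "dsym a = dsym b \<longleftrightarrow> a = b"
  by (auto simp: dsym_def)

fun lsym :: "letter \<Rightarrow> nat" where
  "lsym (Digit b) = dsym b"
| "lsym Minus = 3"
| "lsym Sep = 4"

fun encode :: "bool \<times> int \<Rightarrow> nat list" where
  "encode (b, x) = (if x < 0 then [3] else []) @ map dsym (binary (nat \<bar>x\<bar>)) @ [if b then 5 else 4]"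

definition encodes :: "(bool \<times> int) list \<Rightarrow> nat list" where
  "encodes es = concat (map encode es)"

lemma encodes_simps [simp]:
  "encodes [] = []" "encodes (e # es) = encode e @ encodes es"
  "encodes (es @ es') = encodes es @ encodes es'"
  by (simp_all add: encodes_def)

lemma encode_symbols: "set (encode e) \<subseteq> {0<..<6}"
  by (cases e) auto

lemma encodes_symbols: "set (encodes es) \<subseteq> {0<..<6}"
  using encode_symbols by (auto simp: encodes_def)

lemma encode_ne [simp]: "encode e \<noteq> []"
  by (cases e) auto

lemma peek_append: "xs \<noteq> [] \<Longrightarrow> peek (xs @ ys) = peek xs"
  by (cases xs) auto

lemma peek_encode: "peek (encode e) \<noteq> 0"
  using encode_symbols[of e] by (cases "encode e") auto

lemma length_encode: "length (encode (b, x)) \<ge> length (binary (nat \<bar>x\<bar>)) + 1"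
  by auto

definition sg :: "bool \<Rightarrow> int" where
  "sg b = (if b then - 1 else 1)"

lemma sg_mult: "sg (x < 0) * int (nat \<bar>x\<bar>) = x"
  by (auto simp: sg_def)

lemma cfold_linear:
  "cfold (sg (y < 0) * c1) (sg (x < 0) * c2) (binary (nat \<bar>y\<bar>)) (binary (nat \<bar>x\<bar>)) (Some (- d)) = Some 0
     \<longleftrightarrow> c1 * y + c2 * x = d"
proof -
  have "sg (y < 0) * c1 * int (nat \<bar>y\<bar>) = c1 * y" "sg (x < 0) * c2 * int (nat \<bar>x\<bar>) = c2 * x"
    using sg_mult[of y] sg_mult[of x] by (metis mult.assoc mult.commute)+
  then show ?thesis unfolding cfold_zero bval_binary by linarith
qed

context two_var
begin

text \<open>
  Stack \<open>0\<close> is the input, \<open>1\<close> the list of numbers, \<open>3\<close> the number that is compared with the others and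
  \<open>5\<close> the counter that starts with \<open>k\<close>; \<open>2\<close>, \<open>4\<close> and \<open>6\<close> hold what has been popped from these three,
  in reverse. The unary counters \<open>7\<close> and \<open>8\<close> get the length of the input, from which its square is
  computed on \<open>10\<close>, with the help of \<open>9\<close>.
\<close>

definition parse :: "memory prog" where
  "parse = While (\<lambda>_ t. t 0 \<noteq> 0) (Do
     (\<lambda>m t. case half m of None \<Rightarrow> m\<lparr>half := Some (t 0 = 2)\<rparr>
        | Some a \<Rightarrow> m\<lparr>half := None, st := dfa (st m) (letter_of a (t 0 = 2))\<rparr>)
     (\<lambda>m t. (\<lambda>_. Keep)(0 := Pop, 7 := Push 1, 8 := Push 1,
        (if st m < 2 then 6 else 2) :=
          (case half m of None \<Rightarrow> Keep | Some a \<Rightarrow> let l = letter_of a (t 0 = 2) in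
             if st m < 2 \<and> l = Sep then Keep else Push (lsym l)))))"

fun first_letters :: "nat \<Rightarrow> letter list \<Rightarrow> letter list" where
  "first_letters s [] = []"
| "first_letters s (l # ls) = (if s < 2 \<and> l \<noteq> Sep then [l] else []) @ first_letters (dfa s l) ls"

fun rest_letters :: "nat \<Rightarrow> letter list \<Rightarrow> letter list" where
  "rest_letters s [] = []"
| "rest_letters s (l # ls) = (if s < 2 then [] else [l]) @ rest_letters (dfa s l) ls"

lemma lsym_range: "0 < lsym l \<and> lsym l < 6"
  by (cases l) auto

lemma run_parse_nil:
  assumes "\<sigma> 0 = []"
  shows "run parse m \<sigma> 1 m \<sigma>"
  unfolding parse_def using assms by (intro run_While_False) auto

lemma run_parse_single:
  assumes "\<sigma> 0 = [dsym b]" "m \<in> mems" "half m = None"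
  shows "\<exists>\<sigma>'. run parse m \<sigma> 4 (m\<lparr>half := Some b\<rparr>) \<sigma>'"
proof -
  let ?\<sigma> = "\<sigma>(0 := [], 7 := 1 # \<sigma> 7, 8 := 1 # \<sigma> 8)"
  have "run parse m \<sigma> (2 + 1 + 1) (m\<lparr>half := Some b\<rparr>) ?\<sigma>"
    unfolding parse_def
    apply (rule run_While_True[OF _ run_DoI run_While_False[where n = 1] order.refl])
    using assms by (auto simp: mems_def split: if_splits)
  then show ?thesis by (intro exI) simp
qed

lemma run_parse_letter:
  assumes "\<sigma> 0 = map dsym (letter_bits l) @ r" "m \<in> mems" "half m = None"
    and "run parse (m\<lparr>st := dfa (st m) l\<rparr>)
      (\<sigma>(0 := r, 7 := 1 # 1 # \<sigma> 7, 8 := 1 # 1 # \<sigma> 8,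
         6 := (if st m < 2 \<and> l \<noteq> Sep then [lsym l] else []) @ \<sigma> 6,
         2 := (if st m < 2 then [] else [lsym l]) @ \<sigma> 2)) n m' \<sigma>'"
  shows "run parse m \<sigma> (n + 6) m' \<sigma>'"
proof -
  obtain a b where ab: "letter_bits l = [a, b]" "letter_of a b = l" by (rule letter_bits_cases)
  let ?\<sigma>1 = "\<sigma>(0 := dsym b # r, 7 := 1 # \<sigma> 7, 8 := 1 # \<sigma> 8)"
  show ?thesis
    unfolding parse_def
    apply (rule run_While_True[where na = 2 and ma = "m\<lparr>half := Some a\<rparr>" and \<rho> = ?\<sigma>1 and nb = "n + 3"])
       apply (use assms(1) ab in simp)
      apply (rule run_DoI)
         apply (use assms(1-3) ab in \<open>auto simp: mems_def split: if_splits\<close>)[4]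
     apply (rule run_While_True[OF _ run_DoI assms(4)[unfolded parse_def]])
          apply (use assms(2,3) ab lsym_range in \<open>auto simp: mems_def dfa_le split: if_splits\<close>)
    done
qed

text \<open>The remaining run is a premise since the same loop goes on with what follows the
  complete letters: nothing, or a single bit if the input has odd length.\<close>

lemma run_parse_letters:
  assumes "\<sigma> 0 = map dsym (concat (map letter_bits ls) @ r)" "m \<in> mems" "half m = None"
    and "run parse (m\<lparr>st := foldl dfa (st m) ls\<rparr>)
      (\<sigma>(0 := map dsym r, 7 := replicate (2 * length ls) 1 @ \<sigma> 7, 8 := replicate (2 * length ls) 1 @ \<sigma> 8,
         6 := rev (map lsym (first_letters (st m) ls)) @ \<sigma> 6,
         2 := rev (map lsym (rest_letters (st m) ls)) @ \<sigma> 2)) n m' \<sigma>'"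
  shows "run parse m \<sigma> (n + 6 * length ls) m' \<sigma>'"
  using assms
proof (induction ls arbitrary: m \<sigma>)
  case Nil
  then have "\<sigma>(0 := map dsym r) = \<sigma>" by auto
  with Nil show ?case by simp
next
  case (Cons l ls)
  let ?m = "m\<lparr>st := dfa (st m) l\<rparr>"
  let ?\<sigma> = "\<sigma>(0 := map dsym (concat (map letter_bits ls) @ r), 7 := 1 # 1 # \<sigma> 7, 8 := 1 # 1 # \<sigma> 8,
         6 := (if st m < 2 \<and> l \<noteq> Sep then [lsym l] else []) @ \<sigma> 6,
         2 := (if st m < 2 then [] else [lsym l]) @ \<sigma> 2)"
  have "run parse ?m ?\<sigma> (n + 6 * length ls) m' \<sigma>'"
  proof (rule Cons.IH)
    show "?m \<in> mems" using Cons.prems dfa_le by (simp add: mems_def)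
    have rep: "replicate k (1::nat) @ [1, 1] = 1 # 1 # replicate k 1" for k
      by (induction k) auto
    show "run parse (?m\<lparr>st := foldl dfa (st ?m) ls\<rparr>)
      (?\<sigma>(0 := map dsym r, 7 := replicate (2 * length ls) 1 @ ?\<sigma> 7, 8 := replicate (2 * length ls) 1 @ ?\<sigma> 8,
         6 := rev (map lsym (first_letters (st ?m) ls)) @ ?\<sigma> 6,
         2 := rev (map lsym (rest_letters (st ?m) ls)) @ ?\<sigma> 2)) n m' \<sigma>'"
      using Cons.prems(4)
      by (rule back_subst[where P = "\<lambda>s. run parse _ s n m' \<sigma>'", THEN back_subst[where P = "\<lambda>m. run parse m _ n m' \<sigma>'"]])
        (auto simp: fun_eq_iff rep[simplified])
  qed (use Cons.prems in auto)
  then have "run parse m \<sigma> (n + 6 * length ls + 6) m' \<sigma>'"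
    using Cons.prems by (intro run_parse_letter) auto
  then show ?case by (simp add: algebra_simps)
qed

section \<open>Multiplication of unary counters\<close>

definition quad :: "memory prog" where
  "quad = While (\<lambda>_ t. t 7 \<noteq> 0)
     (Seq (Do (\<lambda>m _. m) (\<lambda>_ _. (\<lambda>_. Keep)(7 := Pop)))
     (Seq (While (\<lambda>_ t. t 8 \<noteq> 0)
        (Do (\<lambda>m _. m) (\<lambda>_ _. (\<lambda>_. Keep)(8 := Pop, 9 := Push 1, 10 := Push 1))))
      (move 9 8)))"

lemma replicate_shift: "replicate n x @ x # xs = x # replicate n x @ xs"
  by (induction n) auto

lemma run_quad_inner:
  assumes "\<sigma> 8 = replicate b 1" "m \<in> mems"
  shows "run (While (\<lambda>_ t. t 8 \<noteq> 0)
        (Do (\<lambda>m _. m) (\<lambda>_ _. (\<lambda>_. Keep)(8 := Pop, 9 := Push 1, 10 := Push 1)))) m \<sigma> (3 * b + 1)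
     m (\<sigma>(8 := [], 9 := replicate b 1 @ \<sigma> 9, 10 := replicate b 1 @ \<sigma> 10))"
  using assms(1)
proof (induction b arbitrary: \<sigma>)
  case 0
  then have eq: "\<sigma>(8 := [], 9 := replicate 0 1 @ \<sigma> 9, 10 := replicate 0 1 @ \<sigma> 10) = \<sigma>" by auto
  show ?case unfolding eq using 0 by (intro run_While_False) auto
next
  case (Suc b)
  let ?\<sigma> = "\<sigma>(8 := replicate b 1, 9 := 1 # \<sigma> 9, 10 := 1 # \<sigma> 10)"
  have eq: "?\<sigma>(8 := [], 9 := replicate b 1 @ ?\<sigma> 9, 10 := replicate b 1 @ ?\<sigma> 10)
      = \<sigma>(8 := [], 9 := replicate (Suc b) 1 @ \<sigma> 9, 10 := replicate (Suc b) 1 @ \<sigma> 10)"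
    by (simp add: fun_eq_iff replicate_shift)
  show ?case
    apply (rule run_While_True[OF _ run_DoI Suc.IH[of ?\<sigma>, unfolded eq]])
    using Suc.prems assms(2) by (auto split: if_splits)
qed

lemma set_replicate_subset: "set (replicate b (1::nat)) \<subseteq> {0<..<6}"
  by auto

lemma run_quad:
  assumes "\<sigma> 7 = replicate a 1" "\<sigma> 8 = replicate b 1" "\<sigma> 9 = []" "m \<in> mems"
  shows "run quad m \<sigma> (a * (6 * b + 7) + 1) m (\<sigma>(7 := [], 10 := replicate (a * b) 1 @ \<sigma> 10))"
  using assms(1-3)
proof (induction a arbitrary: \<sigma>)
  case 0
  then have eq: "\<sigma>(7 := [], 10 := replicate (0 * b) 1 @ \<sigma> 10) = \<sigma>" by auto
  show ?case unfolding eq quad_def using 0 by (intro run_While_False) auto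
next
  case (Suc a)
  let ?\<sigma>1 = "\<sigma>(7 := replicate a 1)"
  let ?\<sigma>2 = "?\<sigma>1(8 := [], 9 := replicate b 1 @ ?\<sigma>1 9, 10 := replicate b 1 @ ?\<sigma>1 10)"
  let ?\<sigma>3 = "\<sigma>(7 := replicate a 1, 10 := replicate b 1 @ \<sigma> 10)"
  have 1: "run (Do (\<lambda>m _. m) (\<lambda>_ _. (\<lambda>_. Keep)(7 := Pop))) m \<sigma> 2 m ?\<sigma>1"
    using Suc.prems assms(4) by (intro run_DoI) (auto split: if_splits)
  have 2: "run (While (\<lambda>_ t. t 8 \<noteq> 0)
        (Do (\<lambda>m _. m) (\<lambda>_ _. (\<lambda>_. Keep)(8 := Pop, 9 := Push 1, 10 := Push 1)))) m ?\<sigma>1 (3 * b + 1) m ?\<sigma>2"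
    using Suc.prems assms(4) by (intro run_quad_inner) auto
  have eq3: "?\<sigma>2(9 := [], 8 := rev (?\<sigma>2 9) @ ?\<sigma>2 8) = ?\<sigma>3"
    using Suc.prems by (auto simp: fun_eq_iff)
  have 3: "run (move 9 8) m ?\<sigma>2 (3 * b + 1) m ?\<sigma>3"
    using run_move[of 9 8 m ?\<sigma>2, unfolded eq3] set_replicate_subset[of b] Suc.prems assms(4)
    by auto
  have "replicate (a * b) (1::nat) @ replicate b 1 = replicate (b + a * b) 1"
    by (simp add: replicate_add[symmetric] add.commute)
  then have eq4: "?\<sigma>3(7 := [], 10 := replicate (a * b) 1 @ ?\<sigma>3 10)
      = \<sigma>(7 := [], 10 := replicate (Suc a * b) 1 @ \<sigma> 10)"
    by (simp add: fun_eq_iff)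
  have 4: "run quad m ?\<sigma>3 (a * (6 * b + 7) + 1) m (\<sigma>(7 := [], 10 := replicate (Suc a * b) 1 @ \<sigma> 10))"
    by (rule Suc.IH[of ?\<sigma>3, unfolded eq4]) (use Suc.prems in auto)
  show ?case
    unfolding quad_def
    by (rule run_While_True[OF _ run_Seq[OF 1 run_Seq[OF 2 3 order.refl] order.refl] 4[unfolded quad_def]])
      (use Suc.prems in auto)
qed

section \<open>A single update: loading, comparing and appending a number\<close>

definition start_x :: "memory prog" where
  "start_x = Cond (\<lambda>_ t. t 1 = 3)
     (Do (\<lambda>m _. m\<lparr>negx := True, carry := Some (- d)\<rparr>) (\<lambda>_ _. (\<lambda>_. Keep)(1 := Pop)))
     (Do (\<lambda>m _. m\<lparr>negx := False, carry := Some (- d)\<rparr>) (\<lambda>_ _ _. Keep))"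

definition digits_x :: "memory prog" where
  "digits_x = While (\<lambda>_ t. t 1 = 1 \<or> t 1 = 2) (Do
     (\<lambda>m t. m\<lparr>carry := cstep (sg (negx m) * c1) (sg (negx m) * c2) (t 1 = 2) (t 1 = 2) (carry m)\<rparr>)
     (\<lambda>_ t. (\<lambda>_. Keep)(1 := Pop, 4 := Push (t 1))))"

text \<open>While the digits are copied, they feed the automaton in both roles, so
  \<open>hit\<close> starts as the loop test. The old mark is dropped, as the new one does not
  depend on it.\<close>

definition load :: "memory prog" where
  "load = Seq start_x (Seq digits_x
     (Seq (Do (\<lambda>m _. m\<lparr>hit := carry m = Some 0 \<and> c1 + c2 \<noteq> 0\<rparr>) (\<lambda>_ _. (\<lambda>_. Keep)(1 := Pop)))
      (move 4 3)))"

lemma peek_digits: "s \<noteq> 3 \<Longrightarrow> peek (map dsym bs @ s # R) \<noteq> 3"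
  by (cases bs) auto

lemma sg_bound: "\<bar>sg b * c1\<bar> + \<bar>sg b' * c2\<bar> \<le> \<bar>c1\<bar> + \<bar>c2\<bar> + \<bar>d\<bar>"
  by (auto simp: sg_def)

lemma cstep_mems:
  "m \<in> mems \<Longrightarrow> m\<lparr>carry := cstep (sg u * c1) (sg v * c2) a b (carry m)\<rparr> \<in> mems"
  using carry_le_cstep sg_bound by (simp add: mems_def)

lemma run_digits_x:
  assumes "\<sigma> 1 = map dsym bs @ s # R" "s = 4 \<or> s = 5" "m \<in> mems"
  shows "m\<lparr>carry := cfold (sg (negx m) * c1) (sg (negx m) * c2) bs bs (carry m)\<rparr> \<in> mems \<and>
    run digits_x m \<sigma> (3 * length bs + 1)
      (m\<lparr>carry := cfold (sg (negx m) * c1) (sg (negx m) * c2) bs bs (carry m)\<rparr>)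
      (\<sigma>(1 := s # R, 4 := rev (map dsym bs) @ \<sigma> 4))"
  using assms(1,3)
proof (induction bs arbitrary: m \<sigma>)
  case Nil
  then have eq: "\<sigma>(1 := s # R, 4 := rev (map dsym []) @ \<sigma> 4) = \<sigma>" by auto
  have "run digits_x m \<sigma> 1 m \<sigma>"
    unfolding digits_x_def using Nil assms(2) by (intro run_While_False) auto
  then show ?case unfolding eq using Nil by simp
next
  case (Cons b bs)
  let ?m = "m\<lparr>carry := cstep (sg (negx m) * c1) (sg (negx m) * c2) b b (carry m)\<rparr>"
  let ?m' = "m\<lparr>carry := cfold (sg (negx m) * c1) (sg (negx m) * c2) (b # bs) (b # bs) (carry m)\<rparr>"
  let ?\<sigma> = "\<sigma>(1 := map dsym bs @ s # R, 4 := dsym b # \<sigma> 4)"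
  have m: "?m \<in> mems" using Cons.prems cstep_mems by blast
  have eq: "?\<sigma>(1 := s # R, 4 := rev (map dsym bs) @ ?\<sigma> 4)
      = \<sigma>(1 := s # R, 4 := rev (map dsym (b # bs)) @ \<sigma> 4)" by auto
  have eqm: "?m\<lparr>carry := cfold (sg (negx ?m) * c1) (sg (negx ?m) * c2) bs bs (carry ?m)\<rparr> = ?m'" by simp
  have IH: "?m' \<in> mems \<and> run digits_x ?m ?\<sigma> (3 * length bs + 1) ?m' (\<sigma>(1 := s # R, 4 := rev (map dsym (b # bs)) @ \<sigma> 4))"
    by (rule Cons.IH[of ?\<sigma> ?m, unfolded eq eqm]) (simp, rule m)
  have "run digits_x m \<sigma> (3 * length (b # bs) + 1) ?m' (\<sigma>(1 := s # R, 4 := rev (map dsym (b # bs)) @ \<sigma> 4))"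
    unfolding digits_x_def
    apply (rule run_While_True[OF _ run_DoI conjunct2[OF IH, unfolded digits_x_def]])
    using Cons.prems m by (auto split: if_splits)
  with IH show ?case by blast
qed

lemma run_load:
  assumes "\<sigma> 1 = encode (b, x) @ R" "\<sigma> 3 = []" "\<sigma> 4 = []" "m \<in> mems"
  shows "\<exists>m'. run load m \<sigma> (6 * length (binary (nat \<bar>x\<bar>)) + 12) m'
        (\<sigma>(1 := R, 3 := map dsym (binary (nat \<bar>x\<bar>)))) \<and>
     m' \<in> mems \<and> negx m' = (x < 0) \<and> hit m' = edge c1 c2 d x x \<and> dup m' = dup m \<and> under m' = under m"
proof -
  let ?bs = "binary (nat \<bar>x\<bar>)" and ?s = "if b then 5 else 4 :: nat"
  let ?m1 = "m\<lparr>negx := x < 0, carry := Some (- d)\<rparr>"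
  let ?r = "cfold (sg (x < 0) * c1) (sg (x < 0) * c2) ?bs ?bs (Some (- d))"
  let ?m2 = "?m1\<lparr>carry := ?r\<rparr>" and ?m3 = "m\<lparr>negx := x < 0, carry := ?r, hit := edge c1 c2 d x x\<rparr>"
  let ?\<sigma>1 = "\<sigma>(1 := map dsym ?bs @ ?s # R)"
  let ?\<sigma>2 = "?\<sigma>1(1 := ?s # R, 4 := rev (map dsym ?bs) @ ?\<sigma>1 4)"
  let ?\<sigma>3 = "?\<sigma>2(1 := R)"
  let ?\<sigma>4 = "\<sigma>(1 := R, 3 := map dsym ?bs)"
  have m1: "?m1 \<in> mems" using assms(4) by (simp add: mems_def carry_le_def)
  have 1: "run start_x m \<sigma> 3 ?m1 ?\<sigma>1"
  proof (cases "x < 0")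
    case True
    show ?thesis unfolding start_x_def
      apply (rule run_Cond[where na = 2])
      using assms True m1 by (auto intro!: run_DoI split: if_splits)
  next
    case False
    then have "tops \<sigma> 1 \<noteq> 3" using assms(1) peek_digits[of ?s ?bs R] by (simp split: if_splits)
    then show ?thesis unfolding start_x_def
      apply (intro run_Cond[where na = 2])
      using assms False m1 by (auto intro!: run_DoI split: if_splits)
  qed
  have 2: "?m2 \<in> mems" "run digits_x ?m1 ?\<sigma>1 (3 * length ?bs + 1) ?m2 ?\<sigma>2"
    using run_digits_x[of ?\<sigma>1 ?bs ?s R ?m1] m1 by simp_all
  \<comment> \<open>On the diagonal, \<open>c1 + c2 \<noteq> 0\<close> covers both exclusions in
    \<open>edge\<close>.\<close>
  have hit: "(?r = Some 0 \<and> c1 + c2 \<noteq> 0) = edge c1 c2 d x x"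
    unfolding cfold_linear edge_def by auto
  have m3: "?m3 \<in> mems" using 2(1) by (simp add: mems_def)
  have 3: "run (Do (\<lambda>m _. m\<lparr>hit := carry m = Some 0 \<and> c1 + c2 \<noteq> 0\<rparr>) (\<lambda>_ _. (\<lambda>_. Keep)(1 := Pop)))
      ?m2 ?\<sigma>2 2 ?m3 ?\<sigma>3"
    using hit m3 by (intro run_DoI) (auto split: if_splits)
  have eq4: "?\<sigma>3(4 := [], 3 := rev (?\<sigma>3 4) @ ?\<sigma>3 3) = ?\<sigma>4" using assms by (auto simp: fun_eq_iff rev_map)
  have 4: "run (move 4 3) ?m3 ?\<sigma>3 (3 * length ?bs + 1) ?m3 ?\<sigma>4"
    using run_move[of 4 3 ?m3 ?\<sigma>3, unfolded eq4] m3 assms(3) by (auto simp: image_subset_iff)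
  have "run load m \<sigma> (6 * length ?bs + 12) ?m3 ?\<sigma>4"
    unfolding load_def
    by (rule run_Seq[OF 1 run_Seq[OF 2(2) run_Seq[OF 3 4 order.refl] order.refl]]) simp
  with m3 show ?thesis by (intro exI[of _ ?m3]) simp
qed

definition start_y :: "memory prog" where
  "start_y = Cond (\<lambda>_ t. t 1 = 3)
     (Do (\<lambda>m _. m\<lparr>negy := True, carry := Some (- d), same := negx m\<rparr>)
        (\<lambda>_ _. (\<lambda>_. Keep)(1 := Pop, 2 := Push 3)))
     (Do (\<lambda>m _. m\<lparr>negy := False, carry := Some (- d), same := \<not> negx m\<rparr>) (\<lambda>_ _ _. Keep))"

text \<open>The shorter number is padded differently for the two purposes: the carry sees digits
  \<open>False\<close>, whereas \<open>same\<close> sees symbol \<open>0\<close>, which differs from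
  both digits. Hence \<open>same\<close> also notices a difference in length.\<close>

definition digits_y :: "memory prog" where
  "digits_y = While (\<lambda>_ t. t 1 = 1 \<or> t 1 = 2 \<or> t 3 \<noteq> 0) (Do
     (\<lambda>m t. m\<lparr>carry := cstep (sg (negy m) * c1) (sg (negx m) * c2) (t 1 = 2) (t 3 = 2) (carry m),
        same := same m \<and> (if t 1 = 1 \<or> t 1 = 2 then t 1 else 0) = t 3\<rparr>)
     (\<lambda>_ t. (\<lambda>_. Keep)(1 := if t 1 = 1 \<or> t 1 = 2 then Pop else Keep,
        2 := if t 1 = 1 \<or> t 1 = 2 then Push (t 1) else Keep,
        3 := Pop, 4 := if t 3 = 0 then Keep else Push (t 3))))"

definition compare :: "memory prog" where
  "compare = Seq start_y (Seq digits_y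
     (Seq (Do (\<lambda>m t. m\<lparr>hit := hit m \<or> carry m = Some 0 \<and> t 1 = 5 \<and> \<not> (c1 = 0 \<and> c2 = 0)
                          \<and> \<not> (same m \<and> c1 + c2 = 0),
                        dup := dup m \<or> same m\<rparr>)
            (\<lambda>_ t. (\<lambda>_. Keep)(1 := Pop, 2 := Push (t 1))))
      (move 4 3)))"

lemma run_digits_y:
  assumes "\<sigma> 1 = map dsym as @ s # R" "s = 4 \<or> s = 5" "\<sigma> 3 = map dsym bs" "m \<in> mems"
  shows "m\<lparr>carry := cfold (sg (negy m) * c1) (sg (negx m) * c2) as bs (carry m),
      same := same m \<and> as = bs\<rparr> \<in> mems \<and>
    run digits_y m \<sigma> (3 * (length as + length bs) + 1)
      (m\<lparr>carry := cfold (sg (negy m) * c1) (sg (negx m) * c2) as bs (carry m),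
         same := same m \<and> as = bs\<rparr>)
      (\<sigma>(1 := s # R, 2 := rev (map dsym as) @ \<sigma> 2, 3 := [], 4 := rev (map dsym bs) @ \<sigma> 4))"
  using assms(1,3,4)
proof (induction "length as + length bs" arbitrary: as bs m \<sigma> rule: less_induct)
  case less
  show ?case
  proof (cases "as = [] \<and> bs = []")
    case True
    then have eq: "\<sigma>(1 := s # R, 2 := rev (map dsym as) @ \<sigma> 2, 3 := [], 4 := rev (map dsym bs) @ \<sigma> 4) = \<sigma>"
      using less.prems by auto
    have "run digits_y m \<sigma> 1 m \<sigma>"
      unfolding digits_y_def using True less.prems assms(2) by (intro run_While_False) auto
    then show ?thesis unfolding eq using True less.prems by simp
  next
    case False
    let ?a = "as \<noteq> [] \<and> hd as" and ?b = "bs \<noteq> [] \<and> hd bs"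
    let ?ta = "if as = [] then [] else [dsym (hd as)]" and ?tb = "if bs = [] then [] else [dsym (hd bs)]"
    let ?m = "m\<lparr>carry := cstep (sg (negy m) * c1) (sg (negx m) * c2) ?a ?b (carry m),
       same := same m \<and> ?ta = ?tb\<rparr>"
    let ?m' = "m\<lparr>carry := cfold (sg (negy m) * c1) (sg (negx m) * c2) as bs (carry m),
       same := same m \<and> as = bs\<rparr>"
    let ?\<sigma> = "\<sigma>(1 := map dsym (tl as) @ s # R, 2 := ?ta @ \<sigma> 2, 3 := map dsym (tl bs), 4 := ?tb @ \<sigma> 4)"
    let ?\<sigma>' = "\<sigma>(1 := s # R, 2 := rev (map dsym as) @ \<sigma> 2, 3 := [], 4 := rev (map dsym bs) @ \<sigma> 4)"
    have m: "?m \<in> mems" using cstep_mems[OF less.prems(3), of "negy m" "negx m" ?a ?b] by (simp add: mems_def)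
    have lt: "length (tl as) + length (tl bs) < length as + length bs"
      using False by (cases as; cases bs) auto
    have eq: "?\<sigma>(1 := s # R, 2 := rev (map dsym (tl as)) @ ?\<sigma> 2, 3 := [], 4 := rev (map dsym (tl bs)) @ ?\<sigma> 4) = ?\<sigma>'"
      by (cases as; cases bs) auto
    have "cfold (sg (negy m) * c1) (sg (negx m) * c2) (tl as) (tl bs)
        (cstep (sg (negy m) * c1) (sg (negx m) * c2) ?a ?b (carry m))
      = cfold (sg (negy m) * c1) (sg (negx m) * c2) as bs (carry m)"
      using False by (cases as; cases bs) auto
    moreover have "(?ta = ?tb \<and> tl as = tl bs) = (as = bs)" by (cases as; cases bs) auto
    ultimately have eqm: "?m\<lparr>carry := cfold (sg (negy ?m) * c1) (sg (negx ?m) * c2) (tl as) (tl bs) (carry ?m),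
       same := same ?m \<and> tl as = tl bs\<rparr> = ?m'"
      by simp
    have IH: "?m' \<in> mems \<and>
        run digits_y ?m ?\<sigma> (3 * (length (tl as) + length (tl bs)) + 1) ?m' ?\<sigma>'"
      by (rule less.hyps[OF lt, of ?\<sigma> ?m, unfolded eq eqm]) (simp, simp, rule m)
    have Do: "run (Do
     (\<lambda>m t. m\<lparr>carry := cstep (sg (negy m) * c1) (sg (negx m) * c2) (t 1 = 2) (t 3 = 2) (carry m),
        same := same m \<and> (if t 1 = 1 \<or> t 1 = 2 then t 1 else 0) = t 3\<rparr>)
     (\<lambda>_ t. (\<lambda>_. Keep)(1 := if t 1 = 1 \<or> t 1 = 2 then Pop else Keep,
        2 := if t 1 = 1 \<or> t 1 = 2 then Push (t 1) else Keep,
        3 := Pop, 4 := if t 3 = 0 then Keep else Push (t 3)))) m \<sigma> 2 ?m ?\<sigma>"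
    proof (rule run_DoI)
      have t1: "tops \<sigma> 1 = (if as = [] then s else dsym (hd as))"
        using less.prems by (cases as) auto
      have t3: "tops \<sigma> 3 = (if bs = [] then 0 else dsym (hd bs))"
        using less.prems by (cases bs) auto
      have d: "dsym b = 1 \<or> dsym b = 2" for b by simp
      show "m\<lparr>carry := cstep (sg (negy m) * c1) (sg (negx m) * c2) (tops \<sigma> 1 = 2) (tops \<sigma> 3 = 2) (carry m),
          same := same m \<and> (if tops \<sigma> 1 = 1 \<or> tops \<sigma> 1 = 2 then tops \<sigma> 1 else 0) = tops \<sigma> 3\<rparr> = ?m"
        unfolding t1 t3 using assms(2) by auto
      show "?m \<in> mems" by (rule m)
      let ?h = "(\<lambda>_. Keep)(1 := if tops \<sigma> 1 = 1 \<or> tops \<sigma> 1 = 2 then Pop else Keep,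
        2 := if tops \<sigma> 1 = 1 \<or> tops \<sigma> 1 = 2 then Push (tops \<sigma> 1) else Keep,
        3 := Pop, 4 := if tops \<sigma> 3 = 0 then Keep else Push (tops \<sigma> 3))"
      have h: "?h = (\<lambda>_. Keep)(1 := if as = [] then Keep else Pop,
        2 := if as = [] then Keep else Push (dsym (hd as)),
        3 := Pop, 4 := if bs = [] then Keep else Push (dsym (hd bs)))"
        unfolding t1 t3 using assms(2) d by auto
      show "0 < a \<and> a < 6" if "?h i = Push a" for i a
        using that unfolding h by (auto split: if_splits)
      show "perform (?h i) (\<sigma> i) = ?\<sigma> i" for i
        unfolding h using less.prems(1,2) by (cases as; cases bs) auto
    qed
    have "run digits_y m \<sigma> (3 * (length as + length bs) + 1) ?m' ?\<sigma>'"
      unfolding digits_y_def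
      apply (rule run_While_True[OF _ Do conjunct2[OF IH, unfolded digits_y_def]])
      using False less.prems lt by (cases as; cases bs; auto)+
    with IH show ?thesis by blast
  qed
qed

lemma same_int: "((y < 0) = (x < 0) \<and> binary (nat \<bar>y\<bar>) = binary (nat \<bar>x\<bar>)) \<longleftrightarrow> y = (x :: int)"
  by (auto simp: binary_eq_iff)

lemma run_compare:
  assumes "\<sigma> 1 = encode (b, y) @ R" "\<sigma> 3 = map dsym (binary (nat \<bar>x\<bar>))" "\<sigma> 4 = []" "m \<in> mems"
    and "negx m = (x < 0)"
  shows "\<exists>m'. run compare m \<sigma> ((6 * length (binary (nat \<bar>x\<bar>)) + 13) * length (encode (b, y))) m'
        (\<sigma>(1 := R, 2 := rev (encode (b, y)) @ \<sigma> 2)) \<and>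
     m' \<in> mems \<and> negx m' = (x < 0) \<and> hit m' = (hit m \<or> b \<and> edge c1 c2 d y x) \<and>
     dup m' = (dup m \<or> y = x) \<and> under m' = under m"
proof -
  let ?as = "binary (nat \<bar>y\<bar>)" and ?bs = "binary (nat \<bar>x\<bar>)" and ?s = "if b then 5 else 4 :: nat"
  let ?pre = "if y < 0 then [3] else [] :: nat list"
  let ?m1 = "m\<lparr>negy := y < 0, carry := Some (- d), same := (y < 0) = (x < 0)\<rparr>"
  let ?r = "cfold (sg (y < 0) * c1) (sg (x < 0) * c2) ?as ?bs (Some (- d))"
  let ?m2 = "m\<lparr>negy := y < 0, carry := ?r, same := y = x\<rparr>"
  let ?m3 = "m\<lparr>negy := y < 0, carry := ?r, same := y = x, hit := hit m \<or> b \<and> edge c1 c2 d y x,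
     dup := dup m \<or> y = x\<rparr>"
  let ?\<sigma>1 = "\<sigma>(1 := map dsym ?as @ ?s # R, 2 := ?pre @ \<sigma> 2)"
  let ?\<sigma>2 = "?\<sigma>1(1 := ?s # R, 2 := rev (map dsym ?as) @ ?\<sigma>1 2, 3 := [], 4 := rev (map dsym ?bs) @ ?\<sigma>1 4)"
  let ?\<sigma>3 = "?\<sigma>2(1 := R, 2 := ?s # rev (map dsym ?as) @ ?\<sigma>1 2)"
  let ?\<sigma>4 = "\<sigma>(1 := R, 2 := rev (encode (b, y)) @ \<sigma> 2)"
  have m1: "?m1 \<in> mems" using assms(4) by (simp add: mems_def carry_le_def)
  have 1: "run start_y m \<sigma> 3 ?m1 ?\<sigma>1"
  proof (cases "y < 0")
    case True
    show ?thesis unfolding start_y_def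
      apply (rule run_Cond[where na = 2])
      using assms True m1 by (auto intro!: run_DoI split: if_splits)
  next
    case False
    then have "tops \<sigma> 1 \<noteq> 3" using assms(1) peek_digits[of ?s ?as R] by (simp split: if_splits)
    then show ?thesis unfolding start_y_def
      apply (intro run_Cond[where na = 2])
      using assms False m1 by (auto intro!: run_DoI split: if_splits)
  qed
  have eqm: "?m1\<lparr>carry := cfold (sg (negy ?m1) * c1) (sg (negx ?m1) * c2) ?as ?bs (carry ?m1),
      same := same ?m1 \<and> ?as = ?bs\<rparr> = ?m2"
    using assms(5) same_int[of y x] by simp
  have 2: "?m2 \<in> mems \<and> run digits_y ?m1 ?\<sigma>1 (3 * (length ?as + length ?bs) + 1) ?m2 ?\<sigma>2"
    by (rule run_digits_y[of ?\<sigma>1 ?as ?s R ?bs ?m1, unfolded eqm]) (use assms(2) m1 in auto)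
  have hit: "(hit m \<or> ?r = Some 0 \<and> ?s = 5 \<and> \<not> (c1 = 0 \<and> c2 = 0) \<and> \<not> (y = x \<and> c1 + c2 = 0))
      = (hit m \<or> b \<and> edge c1 c2 d y x)"
    unfolding cfold_linear edge_def by auto
  have m3: "?m3 \<in> mems" using conjunct1[OF 2] by (simp add: mems_def)
  have 3: "run (Do (\<lambda>m t. m\<lparr>hit := hit m \<or> carry m = Some 0 \<and> t 1 = 5 \<and> \<not> (c1 = 0 \<and> c2 = 0)
                          \<and> \<not> (same m \<and> c1 + c2 = 0),
                        dup := dup m \<or> same m\<rparr>)
            (\<lambda>_ t. (\<lambda>_. Keep)(1 := Pop, 2 := Push (t 1)))) ?m2 ?\<sigma>2 2 ?m3 ?\<sigma>3"
  proof (rule run_DoI)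
    show "?m2\<lparr>hit := hit ?m2 \<or> carry ?m2 = Some 0 \<and> tops ?\<sigma>2 1 = 5 \<and> \<not> (c1 = 0 \<and> c2 = 0)
                          \<and> \<not> (same ?m2 \<and> c1 + c2 = 0), dup := dup ?m2 \<or> same ?m2\<rparr> = ?m3"
      using hit by simp
  qed (use m3 in \<open>auto split: if_splits\<close>)
  have eq4: "?\<sigma>3(4 := [], 3 := rev (?\<sigma>3 4) @ ?\<sigma>3 3) = ?\<sigma>4" using assms by (auto simp: fun_eq_iff rev_map)
  have "run (move 4 3) ?m3 ?\<sigma>3 (3 * length (?\<sigma>3 4) + 1) ?m3 ?\<sigma>4"
    by (rule run_move[of 4 3 ?m3 ?\<sigma>3, unfolded eq4]) (use m3 assms(3) in \<open>auto simp: image_subset_iff\<close>)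
  then have 4: "run (move 4 3) ?m3 ?\<sigma>3 (3 * length ?bs + 1) ?m3 ?\<sigma>4"
    using assms(3) by simp
  \<comment> \<open>Writing the cost as a multiple of the length of the entry makes the costs of a
    scan sum up to a multiple of the length of the list.\<close>
  have le: "6 * length ?bs + 13 + 3 * length ?as \<le> (6 * length ?bs + 13) * length (encode (b, y))"
  proof -
    have "(6 * length ?bs + 13) * (length ?as + 1) \<le> (6 * length ?bs + 13) * length (encode (b, y))"
      by (intro mult_left_mono) auto
    moreover have "6 * length ?bs + 13 + 3 * length ?as \<le> (6 * length ?bs + 13) * (length ?as + 1)"
      by (simp add: algebra_simps)
    ultimately show ?thesis by linarith
  qed
  have "run compare m \<sigma> ((6 * length ?bs + 13) * length (encode (b, y))) ?m3 ?\<sigma>4"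
    unfolding compare_def
    by (rule run_Seq[OF 1 run_Seq[OF conjunct2[OF 2] run_Seq[OF 3 4 order.refl] order.refl]])
      (rule order.trans[OF _ le], simp)
  with m3 show ?thesis using assms(5) by (intro exI[of _ ?m3]) simp
qed

definition scan :: "memory prog" where
  "scan = While (\<lambda>_ t. t 1 \<noteq> 0) compare"

lemma run_scan:
  assumes "\<sigma> 1 = encodes ys" "\<sigma> 3 = map dsym (binary (nat \<bar>x\<bar>))" "\<sigma> 4 = []" "m \<in> mems"
    and "negx m = (x < 0)"
  shows "\<exists>m'. run scan m \<sigma> ((6 * length (binary (nat \<bar>x\<bar>)) + 13 + 1) * length (encodes ys) + 1) m'
        (\<sigma>(1 := [], 2 := rev (encodes ys) @ \<sigma> 2)) \<and>
     m' \<in> mems \<and> negx m' = (x < 0) \<and> hit m' = (hit m \<or> (\<exists>(b, y)\<in>set ys. b \<and> edge c1 c2 d y x)) \<and>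
     dup m' = (dup m \<or> x \<in> snd ` set ys) \<and> under m' = under m"
  using assms
proof (induction ys arbitrary: m \<sigma>)
  case Nil
  then have eq: "\<sigma>(1 := [], 2 := rev (encodes []) @ \<sigma> 2) = \<sigma>" by auto
  have "run scan m \<sigma> 1 m \<sigma>" unfolding scan_def using Nil by (intro run_While_False) auto
  then show ?case unfolding eq using Nil by (intro exI[of _ m]) auto
next
  case (Cons e ys)
  obtain b y where e: "e = (b, y)" by (cases e)
  let ?k = "6 * length (binary (nat \<bar>x\<bar>)) + 13"
  let ?\<sigma> = "\<sigma>(1 := encodes ys, 2 := rev (encode (b, y)) @ \<sigma> 2)"
  let ?\<sigma>' = "\<sigma>(1 := [], 2 := rev (encodes (e # ys)) @ \<sigma> 2)"
  have "\<sigma> 1 = encode (b, y) @ encodes ys" using Cons.prems e by simp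
  from run_compare[OF this Cons.prems(2-5)] obtain m1 where
    1: "run compare m \<sigma> (?k * length (encode (b, y))) m1 ?\<sigma>"
    "m1 \<in> mems" "negx m1 = (x < 0)" "hit m1 = (hit m \<or> b \<and> edge c1 c2 d y x)"
    "dup m1 = (dup m \<or> y = x)" "under m1 = under m" by blast
  have eq: "?\<sigma>(1 := [], 2 := rev (encodes ys) @ ?\<sigma> 2) = ?\<sigma>'" using e by auto
  have "\<exists>m'. run scan m1 ?\<sigma> ((?k + 1) * length (encodes ys) + 1) m' ?\<sigma>' \<and>
     m' \<in> mems \<and> negx m' = (x < 0) \<and> hit m' = (hit m1 \<or> (\<exists>(b, y)\<in>set ys. b \<and> edge c1 c2 d y x)) \<and>
     dup m' = (dup m1 \<or> x \<in> snd ` set ys) \<and> under m' = under m1"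
    by (rule Cons.IH[of ?\<sigma> m1, unfolded eq]) (use Cons.prems 1 in auto)
  then obtain m' where
    2: "run scan m1 ?\<sigma> ((?k + 1) * length (encodes ys) + 1) m' ?\<sigma>'"
     "m' \<in> mems" "negx m' = (x < 0)" "hit m' = (hit m1 \<or> (\<exists>(b, y)\<in>set ys. b \<and> edge c1 c2 d y x))"
     "dup m' = (dup m1 \<or> x \<in> snd ` set ys)" "under m' = under m1"
    by blast
  have "1 \<le> length (encode (b, y))" by (metis encode_ne length_greater_0_conv less_eq_Suc_le One_nat_def)
  then have le: "?k * length (encode (b, y)) + ((?k + 1) * length (encodes ys) + 1) + 1
      \<le> (?k + 1) * length (encodes (e # ys)) + 1"
    unfolding encodes_simps length_append e by (simp only: distrib_left distrib_right mult_1)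
  have "tops \<sigma> 1 \<noteq> 0" using Cons.prems(1) by (simp add: peek_append peek_encode)
  then have "run scan m \<sigma> ((?k + 1) * length (encodes (e # ys)) + 1) m' ?\<sigma>'"
    unfolding scan_def by (rule run_While_True[OF _ 1(1) 2(1)[unfolded scan_def] le])
  moreover have "hit m' = (hit m \<or> (\<exists>(b, y)\<in>set (e # ys). b \<and> edge c1 c2 d y x))"
    unfolding 2(4) 1(4) e by auto
  moreover have "dup m' = (dup m \<or> x \<in> snd ` set (e # ys))" unfolding 2(5) 1(5) e by auto
  moreover have "under m' = under m" using 1(6) 2(6) by simp
  ultimately show ?case using 2(2,3) by blast
qed

text \<open>Stack \<open>2\<close> holds the scanned entries in reverse, so pushing the number and
  its new mark there appends the entry; the final reversal restores the order.\<close>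

definition finish :: "memory prog" where
  "finish = Seq (Cond (\<lambda>m _. negx m)
       (Do (\<lambda>m _. m) (\<lambda>_ _. (\<lambda>_. Keep)(2 := Push 3))) (Do (\<lambda>m _. m) (\<lambda>_ _ _. Keep)))
     (Seq (move 3 2)
     (Seq (Do (\<lambda>m _. m) (\<lambda>m _. (\<lambda>_. Keep)(2 := Push (if hit m then 4 else 5)))) (move 2 1)))"

lemma run_finish:
  assumes "\<sigma> 1 = []" "\<sigma> 2 = rev (encodes ys)" "\<sigma> 3 = map dsym (binary (nat \<bar>x\<bar>))" "m \<in> mems"
    and "negx m = (x < 0)"
  shows "run finish m \<sigma> (6 * (length (encodes ys) + length (encode (b, x))) + 10) m
    (\<sigma>(1 := encodes (ys @ [(\<not> hit m, x)]), 2 := [], 3 := []))"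
proof -
  let ?bs = "binary (nat \<bar>x\<bar>)" and ?s = "if hit m then 4 else 5 :: nat"
  let ?pre = "if x < 0 then [3] else [] :: nat list"
  let ?\<sigma>1 = "\<sigma>(2 := ?pre @ \<sigma> 2)"
  let ?\<sigma>2 = "?\<sigma>1(3 := [], 2 := rev (?\<sigma>1 3) @ ?\<sigma>1 2)"
  let ?\<sigma>3 = "?\<sigma>2(2 := rev (encodes (ys @ [(\<not> hit m, x)])))"
  let ?\<sigma>4 = "\<sigma>(1 := encodes (ys @ [(\<not> hit m, x)]), 2 := [], 3 := [])"
  have 1: "run (Cond (\<lambda>m _. negx m)
       (Do (\<lambda>m _. m) (\<lambda>_ _. (\<lambda>_. Keep)(2 := Push 3))) (Do (\<lambda>m _. m) (\<lambda>_ _ _. Keep))) m \<sigma> 3 m ?\<sigma>1"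
    by (rule run_Cond[where na = 2]) (use assms(4,5) in \<open>auto intro!: run_DoI split: if_splits\<close>)
  have "run (move 3 2) m ?\<sigma>1 (3 * length (?\<sigma>1 3) + 1) m ?\<sigma>2"
    by (rule run_move) (use assms(3,4) in \<open>auto simp: image_subset_iff\<close>)
  then have 2: "run (move 3 2) m ?\<sigma>1 (3 * length ?bs + 1) m ?\<sigma>2" using assms(3) by simp
  have 3: "run (Do (\<lambda>m _. m) (\<lambda>m _. (\<lambda>_. Keep)(2 := Push (if hit m then 4 else 5)))) m ?\<sigma>2 2 m ?\<sigma>3"
    by (rule run_DoI) (use assms in \<open>auto split: if_splits\<close>)
  have eq4: "?\<sigma>3(2 := [], 1 := rev (?\<sigma>3 2) @ ?\<sigma>3 1) = ?\<sigma>4" using assms(1) by (auto simp: fun_eq_iff)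
  have "run (move 2 1) m ?\<sigma>3 (3 * length (?\<sigma>3 2) + 1) m ?\<sigma>4"
    by (rule run_move[of 2 1 m ?\<sigma>3, unfolded eq4])
      (use assms(4) encodes_symbols[of "ys @ [(\<not> hit m, x)]"] in auto)
  then have 4: "run (move 2 1) m ?\<sigma>3 (3 * (length (encodes ys) + length (encode (b, x))) + 1) m ?\<sigma>4"
    by (rule run_mono) simp
  have le: "3 + (3 * length ?bs + 1 + (2 + (3 * (length (encodes ys) + length (encode (b, x))) + 1) + 1) + 1) + 1
      \<le> 6 * (length (encodes ys) + length (encode (b, x))) + 10"
    by simp
  show ?thesis
    unfolding finish_def
    by (rule run_Seq[OF 1 run_Seq[OF 2 run_Seq[OF 3 4 order.refl] order.refl]])
      (rule le)
qed

definition process :: "memory prog" where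
  "process = Seq load (Seq scan finish)"

abbreviation rotated :: "(bool \<times> int) list \<Rightarrow> (bool \<times> int) list" where
  "rotated \<equiv> rotate_mark (edge c1 c2 d)"

definition repeats :: "(bool \<times> int) list \<Rightarrow> bool" where
  "repeats es \<longleftrightarrow> (\<exists>x r. map snd es = x # r \<and> x \<in> set r)"

lemma length_encodes_rotated: "length (encodes (rotated es)) = length (encodes es)"
  by (cases es) auto

lemma run_process:
  assumes "\<sigma> 1 = encodes es" "es \<noteq> []" "\<sigma> 2 = []" "\<sigma> 3 = []" "\<sigma> 4 = []" "m \<in> mems"
  shows "\<exists>m'. run process m \<sigma> (40 * (length (encodes es) + 1) ^ 2) m' (\<sigma>(1 := encodes (rotated es))) \<and>
     m' \<in> mems \<and> dup m' = (dup m \<or> repeats es) \<and> under m' = under m"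
proof -
  obtain b x r where es: "es = (b, x) # r" using assms(2) by (cases es) auto
  let ?bs = "binary (nat \<bar>x\<bar>)"
  let ?\<sigma>1 = "\<sigma>(1 := encodes r, 3 := map dsym ?bs)"
  let ?\<sigma>2 = "?\<sigma>1(1 := [], 2 := rev (encodes r) @ ?\<sigma>1 2)"
  have "\<sigma> 1 = encode (b, x) @ encodes r" using assms(1) es by simp
  from run_load[OF this assms(4,5,6)] obtain m1 where
    1: "run load m \<sigma> (6 * length ?bs + 12) m1 ?\<sigma>1" "m1 \<in> mems" "negx m1 = (x < 0)"
    "hit m1 = edge c1 c2 d x x" "dup m1 = dup m" "under m1 = under m" by blast
  have "\<exists>m'. run scan m1 ?\<sigma>1 ((6 * length ?bs + 13 + 1) * length (encodes r) + 1) m' ?\<sigma>2 \<and>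
     m' \<in> mems \<and> negx m' = (x < 0) \<and> hit m' = (hit m1 \<or> (\<exists>(b, y)\<in>set r. b \<and> edge c1 c2 d y x)) \<and>
     dup m' = (dup m1 \<or> x \<in> snd ` set r) \<and> under m' = under m1"
    by (rule run_scan) (use assms(5) 1 in auto)
  then obtain m2 where
    2: "run scan m1 ?\<sigma>1 ((6 * length ?bs + 13 + 1) * length (encodes r) + 1) m2 ?\<sigma>2"
     "m2 \<in> mems" "negx m2 = (x < 0)" "hit m2 = (hit m1 \<or> (\<exists>(b, y)\<in>set r. b \<and> edge c1 c2 d y x))"
     "dup m2 = (dup m1 \<or> x \<in> snd ` set r)" "under m2 = under m1" by blast
  have rot: "rotated es = r @ [(\<not> hit m2, x)]" using es 1(4) 2(4) by simp
  have eq: "?\<sigma>2(1 := encodes (r @ [(\<not> hit m2, x)]), 2 := [], 3 := []) = \<sigma>(1 := encodes (rotated es))"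
    using rot assms(3,4) by (auto simp: fun_eq_iff)
  have 3: "run finish m2 ?\<sigma>2 (6 * (length (encodes r) + length (encode (b, x))) + 10) m2
      (\<sigma>(1 := encodes (rotated es)))"
    by (rule run_finish[of ?\<sigma>2 r x m2 b, unfolded eq])
      (use assms(3) 2 in auto)
  define W L R where "W = length (encodes es)" and "L = length ?bs" and "R = length (encodes r)"
  have W: "L \<le> W" "R \<le> W" "R + length (encode (b, x)) = W"
    using es length_encode[of x b] by (auto simp: W_def L_def R_def)
  \<comment> \<open>Both factors are estimated by the length \<open>W\<close> of the whole list.
    Rotations preserve it, so one bound serves all rounds.\<close>
  have PP: "(6 * L + 13 + 1) * R \<le> (6 * W + 13 + 1) * W"
    using W by (intro mult_mono add_mono) auto
  have QQ: "6 * W + 12 + ((6 * W + 13 + 1) * W + 1 + (6 * W + 10) + 1) + 1 \<le> 40 * (W + 1) ^ 2"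
    by (simp add: power2_eq_square algebra_simps)
  have aux: "P \<le> P' \<Longrightarrow> 6 * W + 12 + (P' + 1 + (6 * W + 10) + 1) + 1 \<le> Q \<Longrightarrow> L \<le> W \<Longrightarrow>
      6 * L + 12 + (P + 1 + (6 * W + 10) + 1) + 1 \<le> Q" for P P' Q W L :: nat
    by linarith
  have le: "6 * L + 12 + ((6 * L + 13 + 1) * R + 1
      + (6 * (R + length (encode (b, x))) + 10) + 1) + 1 \<le> 40 * (W + 1) ^ 2"
    unfolding W(3) by (rule aux[OF PP QQ W(1)])
  have "run process m \<sigma> (40 * (W + 1) ^ 2) m2 (\<sigma>(1 := encodes (rotated es)))"
    unfolding process_def by (rule run_Seq[OF 1(1) run_Seq[OF 2(1) 3 order.refl] le[unfolded L_def R_def]])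
  moreover have "repeats es = (x \<in> snd ` set r)" by (auto simp: repeats_def es)
  ultimately show ?thesis using 1(2-) 2(2-) W_def by (intro exI[of _ m2]) simp
qed

section \<open>Repeated updates\<close>

definition iterate :: "memory prog" where
  "iterate = While (\<lambda>_ t. t 10 \<noteq> 0 \<and> t 1 \<noteq> 0)
     (Seq (Do (\<lambda>m _. m) (\<lambda>_ _. (\<lambda>_. Keep)(10 := Pop))) process)"

text \<open>The guard also tests stack \<open>1\<close> because \<open>process\<close> relies on a
  first entry. The empty list ends the loop at once, in accordance with the claim, since it is fixed
  by rotation and has no repetition.\<close>

lemma run_iterate:
  assumes "\<sigma> 10 = replicate n 1" "\<sigma> 1 = encodes es" "\<sigma> 2 = []" "\<sigma> 3 = []" "\<sigma> 4 = []" "m \<in> mems"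
  shows "\<exists>m' \<sigma>'. run iterate m \<sigma> (n * (40 * (length (encodes es) + 1) ^ 2 + 4) + 1) m' \<sigma>' \<and>
     m' \<in> mems \<and> dup m' = (dup m \<or> (\<exists>i<n. repeats ((rotated ^^ i) es))) \<and> under m' = under m \<and>
     \<sigma>' 1 = encodes ((rotated ^^ n) es) \<and> \<sigma>' 5 = \<sigma> 5 \<and> \<sigma>' 6 = \<sigma> 6"
  using assms
proof (induction n arbitrary: es m \<sigma>)
  case 0
  have "run iterate m \<sigma> 1 m \<sigma>" unfolding iterate_def using 0 by (intro run_While_False) auto
  then show ?case using 0 by (intro exI[of _ m] exI[of _ \<sigma>]) simp
next
  case (Suc n)
  show ?case
  proof (cases "es = []")
    case True
    have "(rotated ^^ i) [] = []" for i by (induction i) auto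
    moreover have "run iterate m \<sigma> (Suc n * (40 * (length (encodes es) + 1) ^ 2 + 4) + 1) m \<sigma>"
      unfolding iterate_def using Suc.prems True by (intro run_While_False) auto
    ultimately show ?thesis using Suc.prems True
      by (intro exI[of _ m] exI[of _ \<sigma>]) (simp add: repeats_def del: funpow.simps)
  next
    case False
    let ?T = "40 * (length (encodes es) + 1) ^ 2"
    let ?\<sigma>1 = "\<sigma>(10 := replicate n 1)"
    let ?\<sigma>2 = "?\<sigma>1(1 := encodes (rotated es))"
    have 1: "run (Do (\<lambda>m _. m) (\<lambda>_ _. (\<lambda>_. Keep)(10 := Pop))) m \<sigma> 2 m ?\<sigma>1"
      by (rule run_DoI) (use Suc.prems in \<open>auto split: if_splits\<close>)
    have "\<exists>m'. run process m ?\<sigma>1 ?T m' ?\<sigma>2 \<and>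
        m' \<in> mems \<and> dup m' = (dup m \<or> repeats es) \<and> under m' = under m"
      by (rule run_process) (use Suc.prems False in auto)
    then obtain m1 where 2: "run process m ?\<sigma>1 ?T m1 ?\<sigma>2"
      "m1 \<in> mems" "dup m1 = (dup m \<or> repeats es)" "under m1 = under m" by blast
    have "\<exists>m' \<sigma>'. run iterate m1 ?\<sigma>2 (n * (40 * (length (encodes (rotated es)) + 1) ^ 2 + 4) + 1) m' \<sigma>' \<and>
     m' \<in> mems \<and> dup m' = (dup m1 \<or> (\<exists>i<n. repeats ((rotated ^^ i) (rotated es)))) \<and> under m' = under m1 \<and>
     \<sigma>' 1 = encodes ((rotated ^^ n) (rotated es)) \<and> \<sigma>' 5 = ?\<sigma>2 5 \<and> \<sigma>' 6 = ?\<sigma>2 6"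
      by (rule Suc.IH) (use Suc.prems 2 in auto)
    then obtain m' \<sigma>' where 3: "run iterate m1 ?\<sigma>2 (n * (?T + 4) + 1) m' \<sigma>'"
     "m' \<in> mems" "dup m' = (dup m1 \<or> (\<exists>i<n. repeats ((rotated ^^ i) (rotated es))))" "under m' = under m1"
     "\<sigma>' 1 = encodes ((rotated ^^ n) (rotated es))" "\<sigma>' 5 = \<sigma> 5" "\<sigma>' 6 = \<sigma> 6"
      unfolding length_encodes_rotated by auto
    have ne: "tops \<sigma> 10 \<noteq> 0 \<and> tops \<sigma> 1 \<noteq> 0"
      using Suc.prems(1,2) False by (cases es) (auto simp: peek_append peek_encode simp del: encode.simps)
    have "run iterate m \<sigma> (Suc n * (?T + 4) + 1) m' \<sigma>'"
      unfolding iterate_def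
      by (rule run_While_True[OF ne run_Seq[OF 1 2(1) order.refl] 3(1)[unfolded iterate_def]]) simp
    moreover have "(\<exists>i<Suc n. repeats ((rotated ^^ i) es))
        = (repeats es \<or> (\<exists>i<n. repeats ((rotated ^^ i) (rotated es))))"
      unfolding Ex_less_Suc2 funpow_Suc_right by simp
    ultimately show ?thesis using 2 3 unfolding funpow_Suc_right by auto
  qed
qed

section \<open>Comparing \<open>k\<close> with the number of marks\<close>

definition decrement :: "memory prog" where
  "decrement = Seq (While (\<lambda>_ t. t 5 = 1) (Do (\<lambda>m _. m) (\<lambda>_ _. (\<lambda>_. Keep)(5 := Pop, 6 := Push 2))))
     (Seq (Cond (\<lambda>_ t. t 5 = 2) (Do (\<lambda>m _. m) (\<lambda>_ _. (\<lambda>_. Keep)(5 := Pop, 6 := Push 1)))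
       (Do (\<lambda>m _. m\<lparr>under := True\<rparr>) (\<lambda>_ _ _. Keep)))
     (move 6 5))"

lemma run_borrow:
  assumes "\<sigma> 5 = replicate k 1 @ map dsym bs" "bs = [] \<or> hd bs" "m \<in> mems"
  shows "run (While (\<lambda>_ t. t 5 = 1) (Do (\<lambda>m _. m) (\<lambda>_ _. (\<lambda>_. Keep)(5 := Pop, 6 := Push 2)))) m \<sigma>
     (3 * k + 1) m (\<sigma>(5 := map dsym bs, 6 := replicate k 2 @ \<sigma> 6))"
  using assms(1)
proof (induction k arbitrary: \<sigma>)
  case 0
  then have eq: "\<sigma>(5 := map dsym bs, 6 := replicate 0 2 @ \<sigma> 6) = \<sigma>" by auto
  show ?case unfolding eq using 0 assms(2) by (intro run_While_False) (cases bs; auto)+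
next
  case (Suc k)
  let ?\<sigma> = "\<sigma>(5 := replicate k 1 @ map dsym bs, 6 := 2 # \<sigma> 6)"
  have eq: "?\<sigma>(5 := map dsym bs, 6 := replicate k 2 @ ?\<sigma> 6)
      = \<sigma>(5 := map dsym bs, 6 := replicate (Suc k) 2 @ \<sigma> 6)"
    by (simp add: fun_eq_iff replicate_shift)
  show ?case
    apply (rule run_While_True[OF _ run_DoI Suc.IH[of ?\<sigma>, unfolded eq]])
    using Suc.prems assms(3) by (auto split: if_splits)
qed

text \<open>The two outcomes of borrowing: either there is no digit \<open>True\<close> to borrow
  from, or the first one is cleared and the zeros below it become ones. They correspond to the
  branches of the \<open>Cond\<close> in \<open>decrement\<close>.\<close>

lemma dec_split:
  obtains k where "bs = replicate k False" "dec bs = replicate k True" "bval bs = 0"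
  | k bs' where "bs = replicate k False @ True # bs'" "dec bs = replicate k True @ False # bs'" "bval bs \<noteq> 0"
proof (induction bs arbitrary: thesis rule: dec.induct)
  case 1
  then show ?case by simp
next
  case (2 bs)
  show ?case using 2(2)[of 0 bs] by simp
next
  case (3 bs)
  show ?case
  proof (rule 3(1))
    fix k assume "bs = replicate k False" "dec bs = replicate k True" "bval bs = 0"
    then show thesis using 3(2)[of "Suc k"] by simp
  next
    fix k bs' assume "bs = replicate k False @ True # bs'" "dec bs = replicate k True @ False # bs'" "bval bs \<noteq> 0"
    then show thesis using 3(3)[of "Suc k" bs'] by simp
  qed
qed

lemma run_decrement:
  assumes "\<sigma> 5 = map dsym bs" "\<sigma> 6 = []" "m \<in> mems"
  shows "run decrement m \<sigma> (6 * length bs + 10) (m\<lparr>under := under m \<or> bval bs = 0\<rparr>)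
     (\<sigma>(5 := map dsym (dec bs)))"
proof -
  let ?m = "m\<lparr>under := under m \<or> bval bs = 0\<rparr>"
  obtain k bs1 bs2 where split: "bs = replicate k False @ bs1" "dec bs = replicate k True @ bs2"
    "bs1 = [] \<and> bs2 = [] \<and> bval bs = 0 \<or> (\<exists>bs'. bs1 = True # bs' \<and> bs2 = False # bs' \<and> bval bs \<noteq> 0)"
    by (rule dec_split[of bs]) (metis append_Nil2, metis)
  let ?\<sigma>1 = "\<sigma>(5 := map dsym bs1, 6 := replicate k 2 @ \<sigma> 6)"
  let ?\<sigma>2 = "\<sigma>(5 := map dsym (tl bs1), 6 := (if bs1 = [] then [] else [1]) @ replicate k 2)"
  have m: "?m \<in> mems" using assms(3) by (simp add: mems_def)
  have 1: "run (While (\<lambda>_ t. t 5 = 1) (Do (\<lambda>m _. m) (\<lambda>_ _. (\<lambda>_. Keep)(5 := Pop, 6 := Push 2)))) m \<sigma>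
     (3 * k + 1) m ?\<sigma>1"
    by (rule run_borrow) (use assms split in \<open>auto simp: dsym_def\<close>)
  have 2: "run (Cond (\<lambda>_ t. t 5 = 2) (Do (\<lambda>m _. m) (\<lambda>_ _. (\<lambda>_. Keep)(5 := Pop, 6 := Push 1)))
       (Do (\<lambda>m _. m\<lparr>under := True\<rparr>) (\<lambda>_ _ _. Keep))) m ?\<sigma>1 3 ?m ?\<sigma>2"
    by (rule run_Cond[where na = 2])
      (use assms(2) m split(3) in \<open>auto intro!: run_DoI split: if_splits\<close>)
  have eq: "?\<sigma>2(6 := [], 5 := rev (?\<sigma>2 6) @ ?\<sigma>2 5) = \<sigma>(5 := map dsym (dec bs))"
    using assms(2) split(2,3) by (auto simp: fun_eq_iff dsym_def)
  have "run (move 6 5) ?m ?\<sigma>2 (3 * length (?\<sigma>2 6) + 1) ?m (\<sigma>(5 := map dsym (dec bs)))"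
    by (rule run_move[of 6 5 ?m ?\<sigma>2, unfolded eq]) (use m in auto)
  moreover have "3 * length (?\<sigma>2 6) + 1 \<le> 3 * length bs + 1"
    using split by (auto simp: Suc_le_eq)
  ultimately have 3: "run (move 6 5) ?m ?\<sigma>2 (3 * length bs + 1) ?m (\<sigma>(5 := map dsym (dec bs)))"
    by (rule run_mono)
  have "k \<le> length bs" using split(1) by simp
  then show ?thesis
    unfolding decrement_def by (intro run_Seq[OF 1 run_Seq[OF 2 3 order.refl]]) linarith
qed

text \<open>The additional decrement makes the counter underflow iff \<open>k\<close> is at most the number of marks.\<close>

definition count_marks :: "memory prog" where
  "count_marks = Seq (While (\<lambda>_ t. t 1 \<noteq> 0)
       (Seq (Cond (\<lambda>_ t. t 1 = 5) decrement (Do (\<lambda>m _. m) (\<lambda>_ _ _. Keep)))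
         (Do (\<lambda>m _. m) (\<lambda>_ _. (\<lambda>_. Keep)(1 := Pop)))))
     decrement"

text \<open>Decrementing keeps the number of digits, leading zeros included, so the same time bound
  holds for every symbol. Marks are counted by their symbol \<open>5\<close>, which occurs nowhere
  else in an entry.\<close>

lemma run_count_loop:
  assumes "\<sigma> 1 = ss" "0 \<notin> set ss" "\<sigma> 5 = map dsym bs" "\<sigma> 6 = []" "m \<in> mems"
  shows "\<exists>m' \<sigma>' bs'. run (While (\<lambda>_ t. t 1 \<noteq> 0)
       (Seq (Cond (\<lambda>_ t. t 1 = 5) decrement (Do (\<lambda>m _. m) (\<lambda>_ _ _. Keep)))
         (Do (\<lambda>m _. m) (\<lambda>_ _. (\<lambda>_. Keep)(1 := Pop))))) m \<sigma> (length ss * (6 * length bs + 15) + 1) m' \<sigma>' \<and>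
     m' \<in> mems \<and> dup m' = dup m \<and> \<sigma>' 5 = map dsym bs' \<and> \<sigma>' 6 = [] \<and> length bs' = length bs \<and>
     (bs', under m') = (countdown ^^ count_list ss 5) (bs, under m)"
  using assms
proof (induction ss arbitrary: m \<sigma> bs)
  case Nil
  then show ?case by (intro exI[of _ m] exI[of _ \<sigma>] exI[of _ bs]) (auto intro: run_While_False)
next
  case (Cons s ss)
  let ?m1 = "if s = 5 then m\<lparr>under := under m \<or> bval bs = 0\<rparr> else m"
  let ?bs1 = "if s = 5 then dec bs else bs"
  let ?\<sigma>1 = "\<sigma>(5 := map dsym ?bs1)" and ?\<sigma>2 = "\<sigma>(5 := map dsym ?bs1, 1 := ss)"
  have t: "tops \<sigma> 1 = s" using Cons.prems by simp
  have m1: "?m1 \<in> mems" using Cons.prems by (simp add: mems_def)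
  have 1: "run (Cond (\<lambda>_ t. t 1 = 5) decrement (Do (\<lambda>m _. m) (\<lambda>_ _ _. Keep))) m \<sigma> (6 * length bs + 11) ?m1 ?\<sigma>1"
  proof (rule run_Cond[where na = "6 * length bs + 10"])
    show "run (if tops \<sigma> 1 = 5 then decrement else Do (\<lambda>m _. m) (\<lambda>_ _ _. Keep)) m \<sigma> (6 * length bs + 10) ?m1 ?\<sigma>1"
    proof (cases "s = 5")
      case True
      then show ?thesis using run_decrement[of \<sigma> bs m] Cons.prems t by simp
    next
      case False
      have "run (Do (\<lambda>m _. m) (\<lambda>_ _ _. Keep)) m \<sigma> 2 m ?\<sigma>1"
        by (rule run_DoI) (use False Cons.prems in auto)
      then have "run (Do (\<lambda>m _. m) (\<lambda>_ _ _. Keep)) m \<sigma> (6 * length bs + 10) m ?\<sigma>1"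
        by (rule run_mono) simp
      with False t show ?thesis by simp
    qed
  qed simp
  have 2: "run (Do (\<lambda>m _. m) (\<lambda>_ _. (\<lambda>_. Keep)(1 := Pop))) ?m1 ?\<sigma>1 2 ?m1 ?\<sigma>2"
    by (rule run_DoI) (use m1 Cons.prems in \<open>auto split: if_splits\<close>)
  have len: "length ?bs1 = length bs" by simp
  let ?P = "\<lambda>m' \<sigma>' bs'. run (While (\<lambda>_ t. t 1 \<noteq> 0)
       (Seq (Cond (\<lambda>_ t. t 1 = 5) decrement (Do (\<lambda>m _. m) (\<lambda>_ _ _. Keep)))
         (Do (\<lambda>m _. m) (\<lambda>_ _. (\<lambda>_. Keep)(1 := Pop))))) ?m1 ?\<sigma>2 (length ss * (6 * length bs + 15) + 1) m' \<sigma>' \<and>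
     m' \<in> mems \<and> dup m' = dup ?m1 \<and> \<sigma>' 5 = map dsym bs' \<and> \<sigma>' 6 = [] \<and> length bs' = length bs \<and>
     (bs', under m') = (countdown ^^ count_list ss 5) (?bs1, under ?m1)"
  have "\<exists>m' \<sigma>' bs'. ?P m' \<sigma>' bs'"
    by (rule Cons.IH[of ?\<sigma>2 ?bs1 ?m1, unfolded len]) (use Cons.prems m1 in auto)
  then obtain m' \<sigma>' bs' where 3: "?P m' \<sigma>' bs'" by blast
  have ne: "tops \<sigma> 1 \<noteq> 0" using t Cons.prems by auto
  have "run (While (\<lambda>_ t. t 1 \<noteq> 0)
       (Seq (Cond (\<lambda>_ t. t 1 = 5) decrement (Do (\<lambda>m _. m) (\<lambda>_ _ _. Keep)))
         (Do (\<lambda>m _. m) (\<lambda>_ _. (\<lambda>_. Keep)(1 := Pop))))) m \<sigma> (length (s # ss) * (6 * length bs + 15) + 1) m' \<sigma>'"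
    by (rule run_While_True[OF ne run_Seq[OF 1 2 order.refl] conjunct1[OF 3]]) simp
  moreover have "(countdown ^^ count_list (s # ss) 5) (bs, under m)
      = (countdown ^^ count_list ss 5) (?bs1, under ?m1)"
    by (auto simp: funpow_swap1[symmetric] funpow_Suc_right countdown_def simp del: funpow.simps)
  moreover have "dup ?m1 = dup m" by simp
  ultimately show ?case using 3 by (intro exI[of _ m'] exI[of _ \<sigma>'] exI[of _ bs']) argo
qed

lemma run_count_marks:
  assumes "\<sigma> 1 = ss" "0 \<notin> set ss" "\<sigma> 5 = map dsym bs" "\<sigma> 6 = []" "m \<in> mems" "\<not> under m"
  shows "\<exists>m' \<sigma>'. run count_marks m \<sigma> ((length ss + 1) * (6 * length bs + 15)) m' \<sigma>' \<and>
     dup m' = dup m \<and> under m' = (bval bs \<le> count_list ss 5)"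
proof -
  obtain m1 \<sigma>1 bs1 where 1: "run (While (\<lambda>_ t. t 1 \<noteq> 0)
       (Seq (Cond (\<lambda>_ t. t 1 = 5) decrement (Do (\<lambda>m _. m) (\<lambda>_ _ _. Keep)))
         (Do (\<lambda>m _. m) (\<lambda>_ _. (\<lambda>_. Keep)(1 := Pop))))) m \<sigma> (length ss * (6 * length bs + 15) + 1) m1 \<sigma>1"
     "m1 \<in> mems" "dup m1 = dup m" "\<sigma>1 5 = map dsym bs1" "\<sigma>1 6 = []" "length bs1 = length bs"
     "(bs1, under m1) = (countdown ^^ count_list ss 5) (bs, under m)"
    using run_count_loop[OF assms(1-5)] by blast
  let ?m2 = "m1\<lparr>under := under m1 \<or> bval bs1 = 0\<rparr>"
  have 2: "run decrement m1 \<sigma>1 (6 * length bs1 + 10) ?m2 (\<sigma>1(5 := map dsym (dec bs1)))"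
    using run_decrement 1 by blast
  have "run count_marks m \<sigma> ((length ss + 1) * (6 * length bs + 15)) ?m2 (\<sigma>1(5 := map dsym (dec bs1)))"
    unfolding count_marks_def by (rule run_Seq[OF 1(1) 2]) (use 1(6) in simp)
  moreover have "(countdown ^^ Suc (count_list ss 5)) (bs, False) = countdown (bs1, under m1)"
    using 1(7) assms(6) by simp
  then have "under ?m2 = snd ((countdown ^^ Suc (count_list ss 5)) (bs, False))"
    by (simp add: countdown_def)
  then have "under ?m2 = (bval bs \<le> count_list ss 5)" unfolding countdown_iter by auto
  ultimately show ?thesis using 1(3) by (intro exI[of _ ?m2] exI) auto
qed

end

section \<open>Correctness and running time of the whole program\<close>

lemma letters_ge:
  assumes "2 \<le> s"
  shows "two_var.first_letters s ls = []" "two_var.rest_letters s ls = ls"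
  using assms dfa_ge by (induction ls arbitrary: s) (auto simp: two_var.first_letters.simps two_var.rest_letters.simps)

lemma letters_instance:
  assumes "s < 2"
  shows "two_var.first_letters s (map Digit bs @ Sep # ls) = map Digit bs \<and>
    two_var.rest_letters s (map Digit bs @ Sep # ls) = ls"
  using assms
  by (induction bs arbitrary: s)
    (auto simp: two_var.first_letters.simps two_var.rest_letters.simps letters_ge)

text \<open>A separator and the end of an unmarked entry share the symbol \<open>4\<close>. Thus the
  copied input already is the list with all marks cleared, the starting point of the
  updates.\<close>

lemma encodes_int_letters: "map lsym (concat (map int_letters xs)) = encodes (map (Pair False) xs)"
  by (induction xs) (auto simp: int_letters_def nat_letters_def)

lemma length_le_encodes: "length es \<le> length (encodes es)"
proof (induction es)
  case (Cons e es)
  have "1 \<le> length (encode e)" by (metis encode_ne length_greater_0_conv less_eq_Suc_le One_nat_def)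
  with Cons show ?case by simp
qed simp

lemma count_list_encodes: "count_list (encodes es) 5 = length (filter fst es)"
proof (induction es)
  case (Cons e es)
  have "count_list (map dsym bs) 5 = 0" for bs by (induction bs) auto
  then have "count_list (encode e) 5 = (if fst e then 1 else 0)"
    by (cases e) (simp add: count_list_append)
  with Cons show ?case by (simp add: count_list_append)
qed simp

context two_var
begin

definition solver :: "memory prog" where
  "solver = Seq parse (Cond (\<lambda>m _. st m = 2 \<and> half m = None)
     (Seq (move 2 1) (Seq (move 6 5) (Seq quad (Seq iterate count_marks))))
     (Do (\<lambda>m _. m) (\<lambda>_ _ _. Keep)))"

definition initial :: memory where
  "initial = \<lparr>st = 0, half = None, negx = False, negy = False, carry = None, same = False,
     hit = False, dup = False, under = False\<rparr>"

lemma initial_mems: "initial \<in> mems"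
  by (simp add: initial_def mems_def carry_le_def)

lemma input_stacks_dsym: "input_stacks w = (\<lambda>_. [])(0 := map dsym w)"
  unfolding input_stacks_def dsym_def by simp

text \<open>The \<open>N * N\<close> updates, each quadratic in the length of the list, contribute
  at most \<open>44 * P ^ 4\<close>; all other terms have degree at most two and fit into the rest
  of the constant \<open>100\<close>.\<close>

lemma time_bound:
  fixes N W L k :: nat
  assumes "W \<le> N" "k \<le> N"
  shows "1 + 3 * N + ((3 * N + 1) + ((3 * N + 1) + (N * (6 * N + 7) + 1
     + (N * N * (40 * (W + 1) ^ 2 + 4) + 1 + (W + 1) * (6 * k + 15) + 1) + 1) + 1) + 1 + 1) + 1
     \<le> 100 * (N + 1) ^ 4"
proof -
  define P where "P = N + 1"
  have P: "1 \<le> P ^ 4" "P \<le> P ^ 4" "P ^ 2 \<le> P ^ 4"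
    using power_increasing[of 1 4 P] power_increasing[of 2 4 P] by (auto simp: P_def)
  have "N * (6 * N + 7) \<le> P * (7 * P)" by (intro mult_mono) (auto simp: P_def)
  then have 1: "N * (6 * N + 7) \<le> 7 * P ^ 2" by (simp add: power2_eq_square)
  have "N * N * (40 * (W + 1) ^ 2 + 4) \<le> P * P * (40 * P ^ 2 + 4 * P ^ 2)"
    using assms by (intro mult_mono add_mono power_mono) (auto simp: P_def)
  also have "\<dots> = 44 * P ^ 4" by (simp add: power4_eq_xxxx power2_eq_square algebra_simps)
  finally have 2: "N * N * (40 * (W + 1) ^ 2 + 4) \<le> 44 * P ^ 4" .
  have "(W + 1) * (6 * k + 15) \<le> P * (15 * P)" using assms by (intro mult_mono) (auto simp: P_def)
  then have 3: "(W + 1) * (6 * k + 15) \<le> 15 * P ^ 2" by (simp add: power2_eq_square)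
  have "N \<le> P ^ 4" using P(2) by (simp add: P_def)
  with 1 2 3 P show ?thesis unfolding P_def[symmetric] by linarith
qed

lemma repeats_iff:
  assumes "length xs \<le> n"
  shows "(\<exists>i<n. repeats ((rotated ^^ i) (map (Pair False) xs))) \<longleftrightarrow> \<not> distinct xs"
proof -
  have "map snd (map (Pair False) xs) = xs" by (simp add: comp_def)
  then show ?thesis
    unfolding distinct_rotate_iff[OF assms] repeats_def rotate_mark_iter_snd by auto
qed

lemma run_instance:
  assumes L: "coeffs \<L> = [c1, c2]" "rhs \<L> = d" and w: "w = encode_instance xs k"
  shows "\<exists>m \<sigma>. run solver initial (input_stacks w) (100 * (length w + 1) ^ 4) m \<sigma> \<and>
    (under m \<and> \<not> dup m \<longleftrightarrow> distinct xs \<and> has_free_subset \<L> (set xs) k)"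
proof -
  define ls where "ls = nat_letters k @ concat (map int_letters xs)"
  define N where "N = length w"
  let ?es = "map (Pair False) xs" and ?one = "replicate N (1::nat)"
  have w_ls: "w = concat (map letter_bits ls)" using w by (simp add: encode_instance_def ls_def)
  then have N: "N = 2 * length ls" by (simp only: N_def length_letters)
  have dfa: "foldl dfa 0 ls = 2" by (simp add: ls_def dfa_nat_letters dfa_ints)
  have letters: "first_letters 0 ls = map Digit (binary k)" "rest_letters 0 ls = concat (map int_letters xs)"
    using letters_instance[of 0 "binary k" "concat (map int_letters xs)"]
    by (simp_all add: ls_def nat_letters_def)
  have len: "length (encodes ?es) \<le> N" "length (binary k) \<le> N"
    using N arg_cong[OF encodes_int_letters[of xs], of length]
    by (simp_all add: ls_def nat_letters_def)
  have xsN: "length xs \<le> N" using len(1) length_le_encodes[of ?es] by simp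
  let ?m = "initial\<lparr>st := 2\<rparr>"
  have m: "?m \<in> mems" using initial_mems by (simp add: mems_def)
  let ?\<sigma>1 = "(\<lambda>_::nat. [])(7 := ?one, 8 := ?one, 6 := rev (map dsym (binary k)), 2 := rev (encodes ?es))"
  let ?\<sigma>2 = "(\<lambda>_::nat. [])(7 := ?one, 8 := ?one, 6 := rev (map dsym (binary k)), 1 := encodes ?es)"
  let ?\<sigma>3 = "(\<lambda>_::nat. [])(7 := ?one, 8 := ?one, 5 := map dsym (binary k), 1 := encodes ?es)"
  let ?\<sigma>4 = "(\<lambda>_::nat. [])(8 := ?one, 10 := replicate (N * N) 1, 5 := map dsym (binary k), 1 := encodes ?es)"
  have "run parse initial (input_stacks w) (1 + 6 * length ls) ?m ?\<sigma>1"
  proof (rule run_parse_letters[where r = "[]"])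
    have eqs: "(input_stacks w)(0 := map dsym [], 7 := replicate (2 * length ls) 1 @ input_stacks w 7,
        8 := replicate (2 * length ls) 1 @ input_stacks w 8,
        6 := rev (map lsym (first_letters (st initial) ls)) @ input_stacks w 6,
        2 := rev (map lsym (rest_letters (st initial) ls)) @ input_stacks w 2) = ?\<sigma>1"
      unfolding input_stacks_dsym N[symmetric]
      by (auto simp: initial_def letters encodes_int_letters fun_eq_iff)
    have eqm: "initial\<lparr>st := foldl dfa (st initial) ls\<rparr> = ?m" using dfa by (simp add: initial_def)
    show "run parse (initial\<lparr>st := foldl dfa (st initial) ls\<rparr>) ((input_stacks w)(0 := map dsym [], 7 := replicate (2 * length ls) 1 @ input_stacks w 7,
        8 := replicate (2 * length ls) 1 @ input_stacks w 8,
        6 := rev (map lsym (first_letters (st initial) ls)) @ input_stacks w 6,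
        2 := rev (map lsym (rest_letters (st initial) ls)) @ input_stacks w 2)) 1 ?m ?\<sigma>1"
      unfolding eqs eqm by (rule run_parse_nil) simp
  qed (simp add: input_stacks_dsym w_ls, rule initial_mems, simp add: initial_def)
  then have 1: "run parse initial (input_stacks w) (1 + 3 * N) ?m ?\<sigma>1" by (rule run_mono) (simp add: N)
  have eq2: "?\<sigma>1(2 := [], 1 := rev (?\<sigma>1 2) @ ?\<sigma>1 1) = ?\<sigma>2" by (auto simp: fun_eq_iff)
  have "run (move 2 1) ?m ?\<sigma>1 (3 * length (?\<sigma>1 2) + 1) ?m ?\<sigma>2"
    by (rule run_move[of 2 1 ?m ?\<sigma>1, unfolded eq2]) (use m encodes_symbols[of ?es] in auto)
  then have 2: "run (move 2 1) ?m ?\<sigma>1 (3 * N + 1) ?m ?\<sigma>2" by (rule run_mono) (use len in simp)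
  have eq3: "?\<sigma>2(6 := [], 5 := rev (?\<sigma>2 6) @ ?\<sigma>2 5) = ?\<sigma>3" by (auto simp: fun_eq_iff)
  have "run (move 6 5) ?m ?\<sigma>2 (3 * length (?\<sigma>2 6) + 1) ?m ?\<sigma>3"
    by (rule run_move[of 6 5 ?m ?\<sigma>2, unfolded eq3]) (use m in auto)
  then have 3: "run (move 6 5) ?m ?\<sigma>2 (3 * N + 1) ?m ?\<sigma>3" by (rule run_mono) (use len in simp)
  have eq4: "?\<sigma>3(7 := [], 10 := replicate (N * N) 1 @ ?\<sigma>3 10) = ?\<sigma>4" by (auto simp: fun_eq_iff)
  have 4: "run quad ?m ?\<sigma>3 (N * (6 * N + 7) + 1) ?m ?\<sigma>4"
    by (rule run_quad[of ?\<sigma>3 N N ?m, unfolded eq4]) (use m in auto)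
  let ?W = "length (encodes ?es)"
  have "\<exists>m' \<sigma>'. run iterate ?m ?\<sigma>4 (N * N * (40 * (?W + 1) ^ 2 + 4) + 1) m' \<sigma>' \<and>
     m' \<in> mems \<and> dup m' = (dup ?m \<or> (\<exists>i<N * N. repeats ((rotated ^^ i) ?es))) \<and> under m' = under ?m \<and>
     \<sigma>' 1 = encodes ((rotated ^^ (N * N)) ?es) \<and> \<sigma>' 5 = ?\<sigma>4 5 \<and> \<sigma>' 6 = ?\<sigma>4 6"
    by (rule run_iterate) (use m in auto)
  then obtain m1 \<sigma>5 where 5: "run iterate ?m ?\<sigma>4 (N * N * (40 * (?W + 1) ^ 2 + 4) + 1) m1 \<sigma>5"
     "m1 \<in> mems" "dup m1 = (\<exists>i<N * N. repeats ((rotated ^^ i) ?es))" "\<not> under m1"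
     "\<sigma>5 1 = encodes ((rotated ^^ (N * N)) ?es)" "\<sigma>5 5 = map dsym (binary k)" "\<sigma>5 6 = []"
    by (auto simp: initial_def)
  have lenW: "length (encodes ((rotated ^^ n) ?es)) = ?W" for n
    by (induction n) (auto simp: length_encodes_rotated)
  have "0 \<notin> set (encodes ((rotated ^^ (N * N)) ?es))" using encodes_symbols by fastforce
  from run_count_marks[OF 5(5) this 5(6,7,2,4)] obtain m2 \<sigma>6 where 6:
    "run count_marks m1 \<sigma>5 ((?W + 1) * (6 * length (binary k) + 15)) m2 \<sigma>6"
    "dup m2 = dup m1" "under m2 = (k \<le> length (filter fst ((rotated ^^ (N * N)) ?es)))"
    unfolding lenW count_list_encodes by auto
  have "run (if st ?m = 2 \<and> half ?m = None
     then (Seq (move 2 1) (Seq (move 6 5) (Seq quad (Seq iterate count_marks))))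
     else (Do (\<lambda>m _. m) (\<lambda>_ _ _. Keep))) ?m ?\<sigma>1 (3 * N + 1 + (3 * N + 1 + (N * (6 * N + 7) + 1
     + (N * N * (40 * (?W + 1) ^ 2 + 4) + 1 + (?W + 1) * (6 * length (binary k) + 15) + 1) + 1) + 1) + 1) m2 \<sigma>6"
    using run_Seq[OF 2 run_Seq[OF 3 run_Seq[OF 4 run_Seq[OF 5(1) 6(1) order.refl] order.refl] order.refl] order.refl]
    by (simp add: initial_def)
  note 7 = run_Cond[where b = "\<lambda>m _. st m = 2 \<and> half m = None", OF this order.refl]
  have "run solver initial (input_stacks w) (100 * (length w + 1) ^ 4) m2 \<sigma>6"
    unfolding solver_def N_def[symmetric] by (rule run_Seq[OF 1 7 time_bound[OF len]])
  moreover have "under m2 \<and> \<not> dup m2 \<longleftrightarrow> distinct xs \<and> has_free_subset \<L> (set xs) k"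
  proof -
    \<comment> \<open>The number of rounds has to serve both purposes: \<open>length xs\<close>
      rotations expose every repetition, and \<open>length xs * length xs\<close> updates settle all
      marks. The marks are interpreted only for distinct entries; otherwise \<open>dup\<close>
      forces rejection.\<close>
    have "length xs \<le> N * N" using xsN le_square[of N] by linarith
    moreover have "length xs * length xs \<le> N * N" using xsN by (intro mult_mono) auto
    ultimately show ?thesis
      using has_free_subset_marking[OF L] by (auto simp: 5(3) 6(2,3) repeats_iff)
  qed
  ultimately show ?thesis by blast
qed

text \<open>Either the recognizer stops outside state \<open>2\<close> or a single bit is left over.
  In both cases nothing else is run after parsing, and \<open>under\<close> keeps its initial value,
  which means rejection.\<close>

lemma run_invalid:
  assumes w: "\<And>xs k. w \<noteq> encode_instance xs k"
  shows "\<exists>m \<sigma>. run solver initial (input_stacks w) (100 * (length w + 1) ^ 4) m \<sigma> \<and> \<not> under m"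
proof -
  obtain ls r where w_ls: "w = concat (map letter_bits ls) @ r" and r: "length r \<le> 1" by (rule bits_letters)
  let ?m = "initial\<lparr>st := foldl dfa 0 ls\<rparr>"
  have le: "foldl dfa s ls \<le> 5" if "s \<le> 5" for s
    using that by (induction ls arbitrary: s) (auto simp: dfa_le)
  have m: "?m \<in> mems" using initial_mems le[of 0] by (simp add: mems_def)
  define \<tau> where "\<tau> = (input_stacks w)(0 := map dsym r, 7 := replicate (2 * length ls) 1 @ input_stacks w 7,
        8 := replicate (2 * length ls) 1 @ input_stacks w 8,
        6 := rev (map lsym (first_letters (st initial) ls)) @ input_stacks w 6,
        2 := rev (map lsym (rest_letters (st initial) ls)) @ input_stacks w 2)"
  have \<tau>: "\<tau> 0 = map dsym r" by (simp add: \<tau>_def)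
  have "\<exists>m' \<sigma>'. run parse ?m \<tau> 4 m' \<sigma>' \<and> m' \<in> mems \<and> \<not> under m' \<and> \<not> (st m' = 2 \<and> half m' = None)"
  proof (cases r)
    case Nil
    have "foldl dfa 0 ls \<noteq> 2"
    proof
      assume "foldl dfa 0 ls = 2"
      then obtain k xs where "ls = nat_letters k @ concat (map int_letters xs)" using dfa_complete by blast
      then have "w = encode_instance xs k" using w_ls Nil by (simp add: encode_instance_def)
      with w show False by blast
    qed
    moreover have "run parse ?m \<tau> 4 ?m \<tau>" by (rule run_mono[OF run_parse_nil]) (use \<tau> Nil in auto)
    ultimately show ?thesis using m by (intro exI[of _ ?m] exI[of _ \<tau>]) (simp add: initial_def)
  next
    case (Cons b r')
    then have rb: "r = [b]" using r by simp
    let ?m' = "?m\<lparr>half := Some b\<rparr>"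
    have "\<exists>\<sigma>'. run parse ?m \<tau> 4 ?m' \<sigma>'"
      by (rule run_parse_single) (use \<tau> rb m in \<open>auto simp: initial_def\<close>)
    moreover have "?m' \<in> mems" using m by (simp add: mems_def)
    ultimately show ?thesis by (elim exE, intro exI[of _ ?m'] exI) (auto simp: initial_def)
  qed
  then obtain m' \<sigma>' where 1: "run parse ?m \<tau> 4 m' \<sigma>'" "m' \<in> mems" "\<not> under m'"
    "\<not> (st m' = 2 \<and> half m' = None)" by blast
  have 2: "run parse initial (input_stacks w) (4 + 6 * length ls) m' \<sigma>'"
  proof (rule run_parse_letters)
    show "input_stacks w 0 = map dsym (concat (map letter_bits ls) @ r)"
      by (simp add: input_stacks_dsym w_ls)
    show "run parse (initial\<lparr>st := foldl dfa (st initial) ls\<rparr>)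
      ((input_stacks w)(0 := map dsym r, 7 := replicate (2 * length ls) 1 @ input_stacks w 7,
        8 := replicate (2 * length ls) 1 @ input_stacks w 8,
        6 := rev (map lsym (first_letters (st initial) ls)) @ input_stacks w 6,
        2 := rev (map lsym (rest_letters (st initial) ls)) @ input_stacks w 2)) 4 m' \<sigma>'"
      using 1(1) unfolding \<tau>_def by (simp only: initial_def memory.simps)
  qed (use initial_mems in \<open>auto simp: initial_def\<close>)
  have "run (Do (\<lambda>m _. m) (\<lambda>_ _ _. Keep)) m' \<sigma>' 2 m' \<sigma>'" by (rule run_DoI) (use 1 in auto)
  then have "run (if st m' = 2 \<and> half m' = None
     then (Seq (move 2 1) (Seq (move 6 5) (Seq quad (Seq iterate count_marks))))
     else (Do (\<lambda>m _. m) (\<lambda>_ _ _. Keep))) m' \<sigma>' 2 m' \<sigma>'"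
    unfolding if_not_P[OF 1(4)] .
  note 3 = run_Cond[where b = "\<lambda>m _. st m = 2 \<and> half m = None", OF this order.refl]
  have "length ls * 2 \<le> length w" using w_ls by (simp add: length_letters)
  moreover have "1 \<le> (length w + 1) ^ 4" "length w + 1 \<le> (length w + 1) ^ 4"
    using power_increasing[of 1 4 "length w + 1"] by simp_all
  ultimately have "4 + 6 * length ls + (2 + 1) + 1 \<le> 100 * (length w + 1) ^ 4" by linarith
  then have "run solver initial (input_stacks w) (100 * (length w + 1) ^ 4) m' \<sigma>'"
    unfolding solver_def by (rule run_Seq[OF 2 3])
  with 1(3) show ?thesis by blast
qed

lemma Free_Subset_class_P:
  assumes L: "coeffs \<L> = [c1, c2]" "rhs \<L> = d"
  shows "Free_Subset \<L> \<in> class_P"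
proof (rule class_P_run[OF initial_mems, where T = "smult 100 ([:1, 1:] ^ 4)" and acc = "\<lambda>m. under m \<and> \<not> dup m"])
  fix w :: "bool list"
  have T: "poly (smult 100 ([:1, 1:] ^ 4)) (length w) = 100 * (length w + 1) ^ 4"
    by (simp add: poly_power)
  show "\<exists>m \<sigma>. run solver initial (input_stacks w) (poly (smult 100 ([:1, 1:] ^ 4)) (length w)) m \<sigma> \<and>
      (under m \<and> \<not> dup m \<longleftrightarrow> w \<in> Free_Subset \<L>)"
  proof (cases "w \<in> Free_Subset \<L>")
    case True
    then obtain xs k where "w = encode_instance xs k" "distinct xs" "has_free_subset \<L> (set xs) k"
      unfolding Free_Subset_def by blast
    with run_instance[OF L] True T show ?thesis by metis
  next
    case False
    show ?thesis
    proof (cases "\<exists>xs k. w = encode_instance xs k")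
      case True
      then obtain xs k where e: "w = encode_instance xs k" by blast
      with False have "\<not> (distinct xs \<and> has_free_subset \<L> (set xs) k)" unfolding Free_Subset_def by blast
      with run_instance[OF L e] False T show ?thesis by metis
    next
      case invalid: False
      with run_invalid[of w] False T show ?thesis by metis
    qed
  qed
qed

end

theorem theorem2p6:
  fixes \<L> :: lin_eq
  assumes "num_vars \<L> = 2"
  shows "Free_Subset \<L> \<in> class_P"
proof -
  obtain c1 c2 where "coeffs \<L> = [c1, c2]"
    using assms by (auto simp: num_vars_def length_Suc_conv numeral_2_eq_2)
  then show ?thesis using two_var.Free_Subset_class_P by blast
qed

end
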